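(* Suppose that $h\in\mathcal Z_+'$, and let $b\in C_0^\infty(\mathbb R)'$ be the corresponding $b$-function. Let $f_1,f_2\in\mathcal D$, and let $g_j(\xi)=(\Xi f_j)(\xi)=\Gamma(1/2+i\xi)\,\tilde f_j(\xi)$, $j=1,2$, where $\tilde f_j=\mathbf M f_j$ is the Mellin transform of $f_j$. Then $g_1,g_2\in C_0^\infty(\mathbb R)$ and $$\langle h,\bar f_1\star f_2\rangle=\langle b,(\mathcal J\bar g_1)*g_2\rangle .$$
   Context: Notation: $\mathbb R_+=(0,\infty)$; $\Gamma$ is the gamma function; $(\Phi u)(\xi)=(2\pi)^{-1/2}\int_{-\infty}^\infty u(x)e^{-ix\xi}dx$ is the Fourier transform. For a topological vector space $\mathcal L$, $\mathcal L'$ is the space of continuous antilinear functionals; brackets $\langle\cdot,\cdot\rangle$ are linear in the first and antilinear in the second argument. $\mathcal Z$ is the set of Schwartz functions $\varphi$ on $\mathbb R$ that extend to entire functions with $|\varphi(z)|\le C_n(1+|z|)^{-n}e^{r|\operatorname{Im}z|}$ for all $n$ and some $r=r(\varphi)>0$; thus $\Phi:C_0^\infty(\mathbb R)\to\mathcal Z$ and $\Phi^*:\mathcal Z\to C_0^\infty(\mathbb R)$ are bijections, and $\mathcal Z$ carries the corresponding topology. $\mathcal Z_+$ is the set of functions $F$ on $\mathbb R_+$ such that $\Omega(x)=F(e^x)$ belongs to $\mathcal Z$ (with the transferred topology), and $\mathcal Z_+'$ is its dual. For $h\in\mathcal Z_+'$ the distribution $\theta(x)=e^xh(e^x)\in\mathcal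 Z'$ is defined by $\langle\theta,\Omega\rangle=\langle h,F\rangle$ for $\Omega(x)=F(e^x)$. The $b$-function of $h\in\mathcal Z_+'$: put $a=\Phi\theta\in C_0^\infty(\mathbb R)'$, i.e. $\langle a,g\rangle=\langle\theta,\Phi^*g\rangle$ (formally $a(\xi)=(2\pi)^{-1/2}\int_0^\infty h(t)t^{-i\xi}dt$), and $b(\xi)=(2\pi)^{-1/2}a(\xi)\Gamma(1-i\xi)^{-1}\in C_0^\infty(\mathbb R)'$, i.e. $\langle b,G\rangle=(2\pi)^{-1/2}\langle a,\Gamma(1+i\,\cdot)^{-1}G\rangle$. $\mathcal D$ is the set of functions $f$ on $\mathbb R_+$ such that $(Uf)(x)=e^{x/2}f(e^x)$ belongs to $\mathcal Z$. The Mellin transform is $(\mathbf Mf)(\xi)=(2\pi)^{-1/2}\int_0^\infty f(t)t^{-1/2-i\xi}dt=(\Phi Uf)(\xi)$. The Laplace convolution is $(\bar f_1\star f_2)(t)=\int_0^t\overline{f_1(s)}f_2(t-s)ds$; for $f_1,f_2\in\mathcal D$ it belongs to $\mathcal Z_+$. Further $(g_1*g_2)(\xi)=\int_{-\infty}^\infty g_1(\xi-\eta)g_2(\eta)d\eta$ and $(\mathcal Jg)(\xi)=g(-\xi)$. *)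

theory Defs
  imports "HOL-Analysis.Analysis"
begin

text \<open>
  Functions on \<open>\<real>\<close> have type \<^typ>\<open>real \<Rightarrow> complex\<close>. A function on \<open>(0,\<infinity>)\<close> is represented by its
  extension by zero to \<open>(-\<infinity>,0]\<close>, so that equality of functions on \<open>(0,\<infinity>)\<close> is HOL equality.
  A functional is a map \<open>h\<close> of type \<^typ>\<open>(real \<Rightarrow> complex) \<Rightarrow> complex\<close> of which only the values on
  the relevant function space are constrained; \<open>\<langle>h, F\<rangle>\<close> is \<^term>\<open>h F\<close>.
\<close>

definition nth_deriv :: "nat \<Rightarrow> (real \<Rightarrow> complex) \<Rightarrow> real \<Rightarrow> complex" where
  "nth_deriv n u = ((\<lambda>v x. vector_derivative v (at x)) ^^ n) u"

definition smooth_fun :: "(real \<Rightarrow> complex) \<Rightarrow> bool" where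
  "smooth_fun u \<longleftrightarrow> (\<forall>n x. nth_deriv n u differentiable (at x))"

definition schwartz_space :: "(real \<Rightarrow> complex) set" where
  "schwartz_space =
     {u. smooth_fun u \<and> (\<forall>m n. \<exists>C. \<forall>x. \<bar>x\<bar> ^ m * norm (nth_deriv n u x) \<le> C)}"

definition test_functions :: "(real \<Rightarrow> complex) set" where
  "test_functions = {g. smooth_fun g \<and> compact (closure {x. g x \<noteq> 0})}"

definition complex_seminorm_on ::
    "(real \<Rightarrow> complex) set \<Rightarrow> ((real \<Rightarrow> complex) \<Rightarrow> real) \<Rightarrow> bool" where
  "complex_seminorm_on V p \<longleftrightarrow>
     (\<forall>u\<in>V. \<forall>v\<in>V. p (\<lambda>x. u x + v x) \<le> p u + p v) \<and>
     (\<forall>c. \<forall>u\<in>V. p (\<lambda>x. c * u x) = norm c * p u)"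

text \<open>
  The usual inductive limit topology on \<open>C\<^sub>0\<^sup>\<infinity>(\<real>)\<close>: the finest locally convex topology for which
  the inclusion of each Frechet space of smooth functions supported in \<open>[-R,R]\<close> is continuous.
  It is generated by all seminorms whose restrictions to these subspaces are continuous.
\<close>

definition test_seminorm :: "((real \<Rightarrow> complex) \<Rightarrow> real) \<Rightarrow> bool" where
  "test_seminorm p \<longleftrightarrow>
     complex_seminorm_on test_functions p \<and>
     (\<forall>R. \<exists>C N. \<forall>g\<in>test_functions. {x. g x \<noteq> 0} \<subseteq> {-R..R} \<longrightarrow>
        p g \<le> C * (\<Sum>n\<le>N. SUP x. norm (nth_deriv n g x)))"

definition test_topology :: "(real \<Rightarrow> complex) topology" where
  "test_topology = topology_generated_by
     {{g \<in> test_functions. p (\<lambda>x. g x - g0 x) < e} |p g0 e.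
        test_seminorm p \<and> g0 \<in> test_functions \<and> e > 0}"

definition fourier :: "(real \<Rightarrow> complex) \<Rightarrow> real \<Rightarrow> complex" where
  "fourier u \<xi> = of_real (1 / sqrt (2 * pi)) *
     (LINT x|lborel. u x * exp (- \<i> * of_real x * of_real \<xi>))"

definition fourier_adj :: "(real \<Rightarrow> complex) \<Rightarrow> real \<Rightarrow> complex" where
  "fourier_adj g x = of_real (1 / sqrt (2 * pi)) *
     (LINT \<xi>|lborel. g \<xi> * exp (\<i> * of_real x * of_real \<xi>))"

definition Z_space :: "(real \<Rightarrow> complex) set" where
  "Z_space = {\<phi> \<in> schwartz_space. \<exists>\<psi> r. \<psi> holomorphic_on UNIV \<and> (\<forall>x. \<psi> (of_real x) = \<phi> x) \<and> r > 0 \<and>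
     (\<forall>n::nat. \<exists>C. \<forall>z. norm (\<psi> z) \<le> C / (1 + norm z) ^ n * exp (r * \<bar>Im z\<bar>))}"

definition Z_topology :: "(real \<Rightarrow> complex) topology" where
  "Z_topology = pullback_topology Z_space fourier_adj test_topology"

definition Zplus_space :: "(real \<Rightarrow> complex) set" where
  "Zplus_space = {F. (\<forall>t\<le>0. F t = 0) \<and> (\<lambda>x. F (exp x)) \<in> Z_space}"

definition Zplus_topology :: "(real \<Rightarrow> complex) topology" where
  "Zplus_topology = pullback_topology Zplus_space (\<lambda>F x. F (exp x)) Z_topology"

definition antilinear_on ::
    "(real \<Rightarrow> complex) set \<Rightarrow> ((real \<Rightarrow> complex) \<Rightarrow> complex) \<Rightarrow> bool" where
  "antilinear_on V h \<longleftrightarrow>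
     (\<forall>u\<in>V. \<forall>v\<in>V. h (\<lambda>x. u x + v x) = h u + h v) \<and>
     (\<forall>c. \<forall>u\<in>V. h (\<lambda>x. c * u x) = cnj c * h u)"

definition Zplus_dual :: "((real \<Rightarrow> complex) \<Rightarrow> complex) set" where
  "Zplus_dual = {h. antilinear_on Zplus_space h \<and> continuous_map Zplus_topology euclidean h}"

text \<open>\<open>theta_dist h\<close> is the distribution \<open>e\<^sup>x h(e\<^sup>x)\<close>: for \<open>\<Omega>(x) = F(e\<^sup>x)\<close> the argument of \<open>h\<close> is \<open>F\<close>.\<close>

definition theta_dist ::
    "((real \<Rightarrow> complex) \<Rightarrow> complex) \<Rightarrow> (real \<Rightarrow> complex) \<Rightarrow> complex" where
  "theta_dist h \<Omega> = h (\<lambda>t. if t > 0 then \<Omega> (ln t) else 0)"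

definition fourier_dist ::
    "((real \<Rightarrow> complex) \<Rightarrow> complex) \<Rightarrow> (real \<Rightarrow> complex) \<Rightarrow> complex" where
  "fourier_dist \<theta> g = \<theta> (fourier_adj g)"

definition b_function ::
    "((real \<Rightarrow> complex) \<Rightarrow> complex) \<Rightarrow> (real \<Rightarrow> complex) \<Rightarrow> complex" where
  "b_function h G = of_real (1 / sqrt (2 * pi)) *
     fourier_dist (theta_dist h) (\<lambda>\<xi>. inverse (Gamma (1 + \<i> * of_real \<xi>)) * G \<xi>)"

definition D_space :: "(real \<Rightarrow> complex) set" where
  "D_space = {f. (\<forall>t\<le>0. f t = 0) \<and> (\<lambda>x. of_real (exp (x / 2)) * f (exp x)) \<in> Z_space}"

definition mellin :: "(real \<Rightarrow> complex) \<Rightarrow> real \<Rightarrow> complex" where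
  "mellin f \<xi> = of_real (1 / sqrt (2 * pi)) *
     (LINT t:{0<..}|lborel. f t * of_real t powr (- 1 / 2 - \<i> * of_real \<xi>))"

definition Xi_map :: "(real \<Rightarrow> complex) \<Rightarrow> real \<Rightarrow> complex" where
  "Xi_map f \<xi> = Gamma (1 / 2 + \<i> * of_real \<xi>) * mellin f \<xi>"

definition laplace_conv :: "(real \<Rightarrow> complex) \<Rightarrow> (real \<Rightarrow> complex) \<Rightarrow> real \<Rightarrow> complex" where
  "laplace_conv u v t = (LINT s:{0<..<t}|lborel. u s * v (t - s))"

definition convol :: "(real \<Rightarrow> complex) \<Rightarrow> (real \<Rightarrow> complex) \<Rightarrow> real \<Rightarrow> complex" where
  "convol u v \<xi> = (LINT \<eta>|lborel. u (\<xi> - \<eta>) * v \<eta>)"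

definition reflect :: "(real \<Rightarrow> complex) \<Rightarrow> real \<Rightarrow> complex" where
  "reflect g \<xi> = g (- \<xi>)"

end

theory Submission
  imports Defs
    "HOL-Probability.Probability"
    "HOL-Complex_Analysis.Complex_Analysis"
    "HOL-Real_Asymp.Real_Asymp"
begin

text \<open>
  Fourier inversion writes every \<open>f\<close> in \<open>D_space\<close> as a superposition of the powers
  \<open>t powr (-1/2 + i \<xi>)\<close> whose density is a multiple of the compactly supported smooth function \<open>mellin f\<close>.
  The Laplace convolution of two such powers is again a power times a Beta value,
  \<open>Beta (1/2 + i \<xi>) (1/2 + i \<eta>) = \<Gamma>(1/2 + i \<xi>) \<Gamma>(1/2 + i \<eta>) / \<Gamma>(1 + i (\<xi> + \<eta>))\<close>, so the two numerators turn
  \<open>mellin f\<close> into \<open>Xi_map f\<close>, and collecting the exponents \<open>\<xi> + \<eta> = \<zeta>\<close> gives a convolution divided by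
  \<open>\<Gamma>(1 + i \<zeta>)\<close>. Hence the two sides of the identity are \<open>h\<close> applied to one and the same function, up to
  pulling a real constant out of \<open>h\<close>.
\<close>

section \<open>Smooth functions and test functions\<close>

text \<open>\<open>h\<close> is known to be antilinear only on \<open>Zplus_space\<close>, so the
  common function must be shown to lie there before the constant can leave \<open>h\<close>. This
  calls for both halves of the Paley-Wiener correspondence: \<open>fourier\<close> takes
  \<open>Z_space\<close> into \<open>test_functions\<close>, which makes the Mellin transforms
  smooth and compactly supported, and \<open>fourier_adj\<close> leads back. The analytic obstacle
  is that powers with real part -1/2 are unbounded at 0 and not integrable on the half-line. The
  interchanges in the Laplace convolution therefore separate the modulus, whose convolution with
  another such power converges absolutely, from a phase of modulus one. Conjugating
  \<open>f1\<close> reverses its frequencies, whence \<open>reflect\<close>. Each of the two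
  inversions brings a factor 1 / sqrt (2 * pi): one normalises \<open>fourier_adj\<close>, the other
  is the constant in \<open>b_function\<close>.\<close>

lemma nth_deriv_0 [simp]: "nth_deriv 0 u = u"
  by (simp add: nth_deriv_def)

lemma nth_deriv_Suc: "nth_deriv (Suc n) u = (\<lambda>x. vector_derivative (nth_deriv n u) (at x))"
  by (simp add: nth_deriv_def)

lemma has_vector_derivative_nth_deriv:
  assumes "smooth_fun u"
  shows "(nth_deriv n u has_vector_derivative nth_deriv (Suc n) u x) (at x)"
  using assms by (simp add: smooth_fun_def nth_deriv_Suc vector_derivative_works[symmetric])

lemma nth_deriv_eqI:
  assumes "\<And>n x. (D n has_vector_derivative D (Suc n) x) (at x)"
  shows "nth_deriv n (D 0) = D n"
proof (induction n)
  case (Suc n)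
  show ?case
    unfolding nth_deriv_Suc Suc by (rule ext) (rule vector_derivative_at[OF assms])
qed simp

lemma smooth_funI_seq:
  assumes "\<And>n x. (D n has_vector_derivative D (Suc n) x) (at x)"
  shows "smooth_fun (D 0)"
proof -
  have "nth_deriv n (D 0) = D n" for n
    using assms by (rule nth_deriv_eqI)
  then show ?thesis
    using assms by (auto simp: smooth_fun_def differentiable_def has_vector_derivative_def)
qed

text \<open>A choice of derivatives inside \<open>S\<close> gives a map \<open>d\<close>, and the
  iterates of \<open>d\<close> on \<open>u\<close> form a sequence of successive derivatives.
  Smoothness thus reduces to finding a class closed under differentiation, with no formula for the
  nth derivative.\<close>

lemma smooth_fun_coinduct:
  assumes "u \<in> S"
    and "\<And>v. v \<in> S \<Longrightarrow> \<exists>w\<in>S. \<forall>x. (v has_vector_derivative w x) (at x)"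
  shows "smooth_fun u"
proof -
  from assms(2) obtain d where d: "\<And>v. v \<in> S \<Longrightarrow> d v \<in> S"
      "\<And>v x. v \<in> S \<Longrightarrow> (v has_vector_derivative d v x) (at x)"
    by metis
  have "(d ^^ n) u \<in> S" for n
    by (induction n) (use assms(1) d(1) in auto)
  then have "smooth_fun ((d ^^ 0) u)"
    by (intro smooth_funI_seq[of "\<lambda>n. (d ^^ n) u"]) (use d(2) in auto)
  then show ?thesis by simp
qed

lemma nth_deriv_shift: "nth_deriv n (nth_deriv m u) = nth_deriv (n + m) u"
  by (simp add: nth_deriv_def funpow_add)

lemma smooth_fun_nth_deriv:
  assumes "smooth_fun u"
  shows "smooth_fun (nth_deriv n u)"
  using assms unfolding smooth_fun_def nth_deriv_shift by blast

lemma smooth_fun_continuous_on: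
  assumes "smooth_fun u"
  shows "continuous_on A u"
  using has_vector_derivative_nth_deriv[OF assms, of 0]
  by (auto intro!: continuous_at_imp_continuous_on intro: has_vector_derivative_continuous)

text \<open>The Leibniz rule turns a product of derivatives into a sum of two such products; closing
  under sums makes the class stable under differentiation, as \<open>smooth_fun_coinduct\<close>
  demands.\<close>

inductive_set product_span :: "(real \<Rightarrow> complex) \<Rightarrow> (real \<Rightarrow> complex) \<Rightarrow> (real \<Rightarrow> complex) set"
  for u v where
  product: "(\<lambda>x. nth_deriv m u x * nth_deriv n v x) \<in> product_span u v"
| sum: "f \<in> product_span u v \<Longrightarrow> g \<in> product_span u v \<Longrightarrow> (\<lambda>x. f x + g x) \<in> product_span u v"

lemma smooth_fun_mult:
  assumes "smooth_fun u" "smooth_fun v"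
  shows "smooth_fun (\<lambda>x. u x * v x)"
proof (rule smooth_fun_coinduct)
  show "(\<lambda>x. u x * v x) \<in> product_span u v"
    using product_span.product[of 0 u 0 v] by simp
  fix f assume "f \<in> product_span u v"
  then show "\<exists>g\<in>product_span u v. \<forall>x. (f has_vector_derivative g x) (at x)"
  proof induction
    case (product m n)
    show ?case
    proof (intro bexI allI)
      fix x
      show "((\<lambda>x. nth_deriv m u x * nth_deriv n v x) has_vector_derivative
          nth_deriv m u x * nth_deriv (Suc n) v x + nth_deriv (Suc m) u x * nth_deriv n v x) (at x)"
        by (intro has_vector_derivative_mult has_vector_derivative_nth_deriv assms)
    qed (intro product_span.intros)
  next
    case (sum f g)
    then obtain f' g' where fg: "f' \<in> product_span u v" "g' \<in> product_span u v"
      "\<forall>x. (f has_vector_derivative f' x) (at x)" "\<forall>x. (g has_vector_derivative g' x) (at x)"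
      by blast
    show ?case
    proof (intro bexI allI)
      fix x
      show "((\<lambda>x. f x + g x) has_vector_derivative f' x + g' x) (at x)"
        by (intro has_vector_derivative_add fg(3)[rule_format] fg(4)[rule_format])
    qed (intro product_span.intros fg)
  qed
qed

text \<open>The restrictions to the line of all functions holomorphic on \<open>S\<close> are closed
  under differentiation, because \<open>deriv\<close> preserves holomorphy on an open set and the
  inner derivative is the constant \<open>c\<close>.\<close>

lemma smooth_fun_holomorphic:
  assumes hol: "\<phi> holomorphic_on S" and S: "open S" "\<And>x. a + c * complex_of_real x \<in> S"
  shows "smooth_fun (\<lambda>x. \<phi> (a + c * of_real x))"
proof (rule smooth_fun_coinduct)
  let ?F = "{\<lambda>x. \<phi> (a + c * complex_of_real x) |\<phi>. \<phi> holomorphic_on S}"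
  show "(\<lambda>x. \<phi> (a + c * of_real x)) \<in> ?F" using hol by blast
  fix v assume "v \<in> ?F"
  then obtain \<psi> where v: "v = (\<lambda>x. \<psi> (a + c * complex_of_real x))" and \<psi>: "\<psi> holomorphic_on S" by blast
  show "\<exists>w\<in>?F. \<forall>x. (v has_vector_derivative w x) (at x)"
  proof (intro bexI allI)
    show "(\<lambda>x. deriv \<psi> (a + c * complex_of_real x) * c) \<in> ?F"
      using \<psi> S(1) by (auto intro!: exI[of _ "\<lambda>z. deriv \<psi> z * c"] holomorphic_intros)
    fix x
    have "((\<lambda>z. \<psi> (a + c * z)) has_field_derivative deriv \<psi> (a + c * of_real x) * c) (at (of_real x))"
      by (rule DERIV_chain2[where g = "\<lambda>z. a + c * z"])
         (auto intro!: derivative_eq_intros holomorphic_derivI[OF \<psi> S(1)] S(2))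
    then show "(v has_vector_derivative deriv \<psi> (a + c * of_real x) * c) (at x)"
      unfolding v by (rule has_vector_derivative_real_field)
  qed
qed

section \<open>Compact support, and integration of continuous functions vanishing outside an
  interval\<close>

lemma test_functionsI:
  assumes "smooth_fun g" and "\<And>x. \<bar>x\<bar> > R \<Longrightarrow> g x = 0"
  shows "g \<in> test_functions"
proof -
  have "{x. g x \<noteq> 0} \<subseteq> {-R..R}" using assms(2) by force
  then have "bounded {x. g x \<noteq> 0}" by (rule bounded_subset[OF bounded_closed_interval])
  then show ?thesis using assms(1) by (simp add: test_functions_def)
qed

lemma test_functionsE:
  assumes "g \<in> test_functions"
  obtains R where "R > 0" "\<And>x. \<bar>x\<bar> > R \<Longrightarrow> g x = 0"
proof -
  from assms have "bounded {x. g x \<noteq> 0}"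
    using bounded_subset[OF compact_imp_bounded closure_subset] by (auto simp: test_functions_def)
  then obtain R where "R > 0" "\<forall>x\<in>{x. g x \<noteq> 0}. norm x \<le> R" by (auto simp: bounded_pos)
  then show ?thesis by (intro that[of R]) force+
qed

lemma test_functions_smooth: "g \<in> test_functions \<Longrightarrow> smooth_fun g"
  by (simp add: test_functions_def)

lemma nth_deriv_eq_0_outside:
  assumes "\<And>x. \<bar>x\<bar> > R \<Longrightarrow> g x = 0" "\<bar>x\<bar> > R"
  shows "nth_deriv n g x = 0"
  using assms(2)
proof (induction n arbitrary: x)
  case (Suc n)
  have "open {x. \<bar>x\<bar> > R}" by (intro open_Collect_less continuous_intros)
  then have "(nth_deriv n g has_vector_derivative 0) (at x)"
    by (rule has_vector_derivative_transform_within_open[where f = "\<lambda>_. 0", rotated]) (use Suc in auto)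
  then show ?case unfolding nth_deriv_Suc by (rule vector_derivative_at)
qed (simp add: assms(1))

lemma continuous_vanishing_outside_integrable:
  fixes g :: "real \<Rightarrow> complex"
  assumes "continuous_on UNIV g" and "\<And>x. \<bar>x\<bar> > R \<Longrightarrow> g x = 0"
  shows "integrable lborel g"
proof -
  have "set_integrable lborel {-R..R} g"
    by (rule borel_integrable_atLeastAtMost') (rule continuous_on_subset[OF assms(1)], simp)
  also have "(\<lambda>x. indicator {-R..R} x *\<^sub>R g x) = g"
    using assms(2) by (auto simp: indicator_def fun_eq_iff abs_if split: if_splits)
  ultimately show ?thesis unfolding set_integrable_def by simp
qed

lemma continuous_vanishing_outside_bounded:
  fixes g :: "real \<Rightarrow> complex"
  assumes "continuous_on UNIV g" and "\<And>x. \<bar>x\<bar> > R \<Longrightarrow> g x = 0"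
  obtains B where "B \<ge> 0" "\<And>x. norm (g x) \<le> B"
proof -
  have "compact (g ` {-R..R})"
    by (intro compact_continuous_image continuous_on_subset[OF assms(1)]) auto
  then obtain B where "B > 0" "\<forall>y\<in>g ` {-R..R}. norm y \<le> B"
    using bounded_pos compact_imp_bounded by blast
  then show ?thesis
    using assms(2) by (intro that[of B]) (force simp: not_less abs_le_iff)+
qed

lemma lborel_integral_vanishing_outside:
  fixes g :: "real \<Rightarrow> complex"
  assumes "continuous_on UNIV g" and "\<And>x. \<bar>x\<bar> > R \<Longrightarrow> g x = 0"
  shows "(LINT x|lborel. g x) = integral {-R..R} g"
proof -
  have g: "(\<lambda>x. indicator {-R..R} x *\<^sub>R g x) = g"
    using assms(2) by (auto simp: indicator_def fun_eq_iff abs_if split: if_splits)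
  have "set_integrable lborel {-R..R} g"
    by (rule borel_integrable_atLeastAtMost') (rule continuous_on_subset[OF assms(1)], simp)
  from set_borel_integral_eq_integral(2)[OF this] show ?thesis
    unfolding set_lebesgue_integral_def g .
qed

text \<open>The product of \<open>a\<close> and \<open>b\<close> is integrable on the plane, and a
  bounded measurable factor preserves this. Every later exchange of integrals rests on this lemma
  except the one in \<open>integral_convolution\<close>.\<close>

lemma fubini_bounded_kernel:
  fixes a b :: "real \<Rightarrow> complex" and K :: "real \<Rightarrow> real \<Rightarrow> complex"
  assumes a: "integrable lborel a" and b: "integrable lborel b"
    and K [measurable]: "(\<lambda>(x, y). K x y) \<in> borel_measurable (lborel \<Otimes>\<^sub>M lborel)"
    and bound: "\<And>x y. norm (K x y) \<le> B"
  shows "(LINT x|lborel. LINT y|lborel. a x * b y * K x y)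
       = (LINT y|lborel. LINT x|lborel. a x * b y * K x y)"
proof -
  note [measurable] = borel_measurable_integrable[OF a] borel_measurable_integrable[OF b]
  have "integrable (lborel \<Otimes>\<^sub>M lborel) (\<lambda>(x, y). a x * b y * K x y)"
  proof (rule Bochner_Integration.integrable_bound)
    show "integrable (lborel \<Otimes>\<^sub>M lborel) (\<lambda>(x, y). complex_of_real B * a x * b y)"
    proof (rule lborel_pair.Fubini_integrable)
      have "integrable lborel (\<lambda>x. norm (complex_of_real B * a x) * (LINT y|lborel. norm (b y)))"
        using a by (intro integrable_mult_left integrable_norm integrable_mult_right)
      then show "integrable lborel (\<lambda>x. LINT y|lborel. norm (case (x, y) of (x, y) \<Rightarrow> complex_of_real B * a x * b y))"
        by (simp add: norm_mult mult.assoc)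
      show "AE x in lborel. integrable lborel (\<lambda>y. case (x, y) of (x, y) \<Rightarrow> complex_of_real B * a x * b y)"
        using b by auto
    qed measurable
    show "AE x in lborel \<Otimes>\<^sub>M lborel. norm (case x of (x, y) \<Rightarrow> a x * b y * K x y)
        \<le> norm (case x of (x, y) \<Rightarrow> complex_of_real B * a x * b y)"
    proof (rule AE_I2, clarify)
      fix x y
      have "norm (a x) * norm (b y) * norm (K x y) \<le> norm (a x) * norm (b y) * \<bar>B\<bar>"
        using bound[of x y] by (intro mult_left_mono) auto
      then show "norm (a x * b y * K x y) \<le> norm (complex_of_real B * a x * b y)"
        by (simp add: norm_mult mult_ac)
    qed
  qed measurable
  from lborel_pair.Fubini_integral[OF this] show ?thesis by simp
qed

section \<open>Fourier transforms of test functions\<close>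

text \<open>The integral in \<open>fourier_adj\<close> at a complex argument and without its
  normalisation: up to that constant, it is the entire extension that membership in
  \<open>Z_space\<close> asks for.\<close>

definition fourier_laplace :: "(real \<Rightarrow> complex) \<Rightarrow> complex \<Rightarrow> complex" where
  "fourier_laplace g z = (LINT \<xi>|lborel. g \<xi> * exp (\<i> * z * of_real \<xi>))"

lemma fourier_adj_eq_fourier_laplace:
  "fourier_adj g x = of_real (1 / sqrt (2 * pi)) * fourier_laplace g (of_real x)"
  by (simp add: fourier_adj_def fourier_laplace_def)

lemma fourier_laplace_eq_integral:
  assumes "continuous_on UNIV g" and "\<And>x. \<bar>x\<bar> > R \<Longrightarrow> g x = 0"
  shows "fourier_laplace g z = integral {-R..R} (\<lambda>\<xi>. g \<xi> * exp (\<i> * z * of_real \<xi>))"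
  unfolding fourier_laplace_def
  by (rule lborel_integral_vanishing_outside) (auto intro!: continuous_intros assms)

text \<open>Compact support turns the integral into one over a fixed interval, where the integrand
  is jointly continuous and entire in \<open>z\<close>, so differentiation under the integral is
  allowed.\<close>

lemma has_field_derivative_fourier_laplace:
  assumes g: "continuous_on UNIV g" and R: "\<And>x. \<bar>x\<bar> > R \<Longrightarrow> g x = 0"
  shows "(fourier_laplace g has_field_derivative fourier_laplace (\<lambda>\<xi>. \<i> * of_real \<xi> * g \<xi>) z) (at z)"
proof -
  have cont: "continuous_on X (\<lambda>x. g (f x))" if "continuous_on X f" for X :: "'a::topological_space set" and f
    using continuous_on_compose2[OF g that] by simp
  have "((\<lambda>z. integral (cbox (-R) R) (\<lambda>\<xi>. g \<xi> * exp (\<i> * z * of_real \<xi>))) has_field_derivative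
     integral (cbox (-R) R) (\<lambda>\<xi>. (\<i> * of_real \<xi> * g \<xi>) * exp (\<i> * z * of_real \<xi>))) (at z)"
    by (rule leibniz_rule_field_derivative)
       (auto intro!: derivative_eq_intros integrable_continuous_interval continuous_intros cont simp: split_beta)
  moreover have "fourier_laplace g = (\<lambda>z. integral {-R..R} (\<lambda>\<xi>. g \<xi> * exp (\<i> * z * of_real \<xi>)))"
    by (rule ext) (rule fourier_laplace_eq_integral, fact+)
  moreover have "fourier_laplace (\<lambda>\<xi>. \<i> * of_real \<xi> * g \<xi>) z
      = integral {-R..R} (\<lambda>\<xi>. \<i> * of_real \<xi> * g \<xi> * exp (\<i> * z * of_real \<xi>))"
    by (rule fourier_laplace_eq_integral) (auto intro!: continuous_intros g R)
  ultimately show ?thesis by simp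
qed

text \<open>Integration by parts: a factor \<open>z\<close> is traded for a derivative of
  \<open>g\<close>, and the boundary terms vanish by compact support.\<close>

lemma fourier_laplace_deriv:
  assumes g: "smooth_fun g" and R: "\<And>x. \<bar>x\<bar> > R \<Longrightarrow> g x = 0" "R \<ge> 0"
  shows "z * fourier_laplace g z = \<i> * fourier_laplace (nth_deriv (Suc 0) g) z"
proof -
  let ?e = "\<lambda>\<xi>::real. exp (\<i> * z * of_real \<xi>)"
  \<comment> \<open>The hypothesis gives zeros of \<open>g\<close> only strictly beyond
    \<open>R\<close>, so the interval is widened by one to have them at its endpoints.\<close>
  have eq0: "g (R + 1) = 0" "g (- R - 1) = 0"
    using R by auto
  have R': "\<And>x. \<bar>x\<bar> > R + 1 \<Longrightarrow> g x = 0" using R(1) by auto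
  have c: "continuous_on X g" "continuous_on X (nth_deriv (Suc 0) g)" for X
    using g by (auto intro: smooth_fun_continuous_on smooth_fun_nth_deriv)
  have "((\<lambda>\<xi>. g \<xi> * (\<i> * z * ?e \<xi>) + nth_deriv (Suc 0) g \<xi> * ?e \<xi>) has_integral
      g (R + 1) * ?e (R + 1) - g (- (R + 1)) * ?e (- (R + 1))) {- (R + 1)..R + 1}"
  proof (rule fundamental_theorem_of_calculus)
    fix x
    have "((\<lambda>w. exp (\<i> * z * w)) has_field_derivative \<i> * z * ?e x) (at (of_real x))"
      by (auto intro!: derivative_eq_intros)
    then have "(?e has_vector_derivative \<i> * z * ?e x) (at x)"
      by (rule has_vector_derivative_real_field)
    then show "((\<lambda>\<xi>. g \<xi> * ?e \<xi>) has_vector_derivative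
        g x * (\<i> * z * ?e x) + nth_deriv (Suc 0) g x * ?e x) (at x within {- (R + 1)..R + 1})"
      using has_vector_derivative_nth_deriv[OF g, of 0 x]
      by (intro has_vector_derivative_at_within[OF has_vector_derivative_mult]) auto
  qed (use R in auto)
  then have "integral {- (R + 1)..R + 1} (\<lambda>\<xi>. g \<xi> * (\<i> * z * ?e \<xi>) + nth_deriv (Suc 0) g \<xi> * ?e \<xi>) = 0"
    using eq0 by (simp add: integral_unique)
  also have "integral {- (R + 1)..R + 1} (\<lambda>\<xi>. g \<xi> * (\<i> * z * ?e \<xi>) + nth_deriv (Suc 0) g \<xi> * ?e \<xi>)
    = integral {- (R + 1)..R + 1} (\<lambda>\<xi>. \<i> * z * (g \<xi> * ?e \<xi>))
      + integral {- (R + 1)..R + 1} (\<lambda>\<xi>. nth_deriv (Suc 0) g \<xi> * ?e \<xi>)"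
    by (subst integral_add[symmetric])
       (auto intro!: integrable_continuous_interval continuous_intros c simp: mult_ac)
  also have "\<dots> = \<i> * z * fourier_laplace g z + fourier_laplace (nth_deriv (Suc 0) g) z"
    using nth_deriv_eq_0_outside[of "R + 1" g, OF R']
    by (simp add: fourier_laplace_eq_integral[OF c(1) R'] fourier_laplace_eq_integral[OF c(2), of "R + 1"])
  finally have "fourier_laplace (nth_deriv (Suc 0) g) z = - (\<i> * z * fourier_laplace g z)"
    by (simp add: add_eq_0_iff)
  then show ?thesis by (simp add: mult.assoc[symmetric])
qed

text \<open>The kernel has modulus exp (- Im z * \<xi>), which is at most exp (R * \<bar>Im z\<bar>)
  on the support of \<open>g\<close>.\<close>

lemma fourier_laplace_bounded:
  assumes g: "continuous_on UNIV g" and R: "\<And>x. \<bar>x\<bar> > R \<Longrightarrow> g x = 0" "R \<ge> 0"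
  shows "\<exists>C\<ge>0. \<forall>z. norm (fourier_laplace g z) \<le> C * exp (R * \<bar>Im z\<bar>)"
proof -
  obtain B where B: "B \<ge> 0" "\<And>x. norm (g x) \<le> B"
    using continuous_vanishing_outside_bounded[OF g R(1)] by blast
  have c: "continuous_on X g" for X
    using g by (rule continuous_on_subset) simp
  have "norm (fourier_laplace g z) \<le> 2 * R * B * exp (R * \<bar>Im z\<bar>)" for z
  proof -
    have "norm (fourier_laplace g z) \<le> (B * exp (R * \<bar>Im z\<bar>)) * (R - (- R))"
      unfolding fourier_laplace_eq_integral[of g R z, OF g R(1), simplified]
    proof (rule integral_bound)
      fix \<xi> assume \<xi>: "\<xi> \<in> {-R..R}"
      have "- (Im z * \<xi>) \<le> \<bar>\<xi>\<bar> * \<bar>Im z\<bar>" by (metis abs_ge_minus_self abs_mult mult.commute)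
      also have "\<dots> \<le> R * \<bar>Im z\<bar>" using \<xi> by (intro mult_right_mono) auto
      finally show "norm (g \<xi> * exp (\<i> * z * of_real \<xi>)) \<le> B * exp (R * \<bar>Im z\<bar>)"
        using B by (auto simp: norm_mult intro!: mult_mono)
    qed (use R in \<open>auto intro!: continuous_intros c\<close>)
    then show ?thesis by (simp add: mult_ac)
  qed
  then show ?thesis using B R by (intro exI[of _ "2 * R * B"]) auto
qed

text \<open>One of the factors 1 + norm z is split off: its summand 1 leaves \<open>g\<close>, its
  summand norm z is exchanged for the derivative of \<open>g\<close>. The induction therefore runs
  over all \<open>g\<close> supported in the same interval.\<close>

lemma fourier_laplace_rapidly_decreasing:
  assumes g: "smooth_fun g" and R: "\<And>x. \<bar>x\<bar> > R \<Longrightarrow> g x = 0" "R \<ge> 0"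
  shows "\<exists>C\<ge>0. \<forall>z. (1 + norm z) ^ n * norm (fourier_laplace g z) \<le> C * exp (R * \<bar>Im z\<bar>)"
  using g R(1)
proof (induction n arbitrary: g)
  case 0
  then show ?case
    using fourier_laplace_bounded[OF smooth_fun_continuous_on _ R(2)] by simp
next
  case (Suc n)
  obtain C where C: "C \<ge> 0" "\<And>z. (1 + norm z) ^ n * norm (fourier_laplace g z) \<le> C * exp (R * \<bar>Im z\<bar>)"
    using Suc.IH[OF Suc.prems] by blast
  obtain D where D: "D \<ge> 0"
    "\<And>z. (1 + norm z) ^ n * norm (fourier_laplace (nth_deriv (Suc 0) g) z) \<le> D * exp (R * \<bar>Im z\<bar>)"
    using Suc.IH[of "nth_deriv (Suc 0) g"] Suc.prems smooth_fun_nth_deriv nth_deriv_eq_0_outside by blast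
  have "(1 + norm z) ^ Suc n * norm (fourier_laplace g z) \<le> (C + D) * exp (R * \<bar>Im z\<bar>)" for z
  proof -
    have "norm z * norm (fourier_laplace g z) = norm (fourier_laplace (nth_deriv (Suc 0) g) z)"
      using arg_cong[OF fourier_laplace_deriv[OF Suc.prems R(2), of z], of norm]
      by (simp add: norm_mult)
    then have "(1 + norm z) ^ Suc n * norm (fourier_laplace g z)
      = (1 + norm z) ^ n * norm (fourier_laplace g z)
        + (1 + norm z) ^ n * norm (fourier_laplace (nth_deriv (Suc 0) g) z)"
      by (simp add: distrib_right distrib_left mult_ac)
    also have "\<dots> \<le> C * exp (R * \<bar>Im z\<bar>) + D * exp (R * \<bar>Im z\<bar>)"
      by (intro add_mono C D)
    finally show ?thesis by (simp add: distrib_right)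
  qed
  then show ?case using C D by (intro exI[of _ "C + D"]) auto
qed

text \<open>The direct half of Paley-Wiener. All derivatives of the transform are again transforms
  of test functions with the same support bound, so one decay estimate serves both the Schwartz
  seminorms and the entire extension.\<close>

theorem fourier_adj_in_Z_space:
  assumes "g \<in> test_functions"
  shows "fourier_adj g \<in> Z_space"
proof -
  obtain R where R: "R > 0" "\<And>x. \<bar>x\<bar> > R \<Longrightarrow> g x = 0"
    using test_functionsE[OF assms] by blast
  have g: "smooth_fun g" by (rule test_functions_smooth) fact
  \<comment> \<open>Differentiating the transform n times multiplies the density by (i
    \<xi>)^n.\<close>
  define G where "G n = (\<lambda>\<xi>. (\<i> * complex_of_real \<xi>) ^ n * g \<xi>)" for n
  have smooth_G: "smooth_fun (G n)" for n
    unfolding G_def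
    using smooth_fun_holomorphic[of "\<lambda>z. (\<i> * z) ^ n" UNIV 0 1]
    by (intro smooth_fun_mult g) (auto intro!: holomorphic_intros)
  have supp_G: "\<bar>x\<bar> > R \<Longrightarrow> G n x = 0" for n x
    using R by (simp add: G_def)
  have G_Suc: "G (Suc n) = (\<lambda>\<xi>. \<i> * of_real \<xi> * G n \<xi>)" for n
    by (simp add: G_def fun_eq_iff mult_ac)
  let ?c = "complex_of_real (1 / sqrt (2 * pi))"
  have deriv: "(fourier_adj (G n) has_vector_derivative fourier_adj (G (Suc n)) x) (at x)" for n x
  proof -
    have "((\<lambda>z. ?c * fourier_laplace (G n) z) has_field_derivative ?c * fourier_laplace (G (Suc n)) (of_real x))
        (at (of_real x))"
      unfolding G_Suc
      by (intro DERIV_cmult has_field_derivative_fourier_laplace smooth_fun_continuous_on smooth_G supp_G)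
    from has_vector_derivative_real_field[OF this] show ?thesis
      by (simp add: fourier_adj_eq_fourier_laplace[abs_def])
  qed
  have G0: "G 0 = g" by (simp add: G_def)
  have smooth: "smooth_fun (fourier_adj g)"
    using smooth_funI_seq[of "\<lambda>n. fourier_adj (G n)"] deriv G0 by simp
  have nth: "nth_deriv n (fourier_adj g) = fourier_adj (G n)" for n
    using nth_deriv_eqI[of "\<lambda>n. fourier_adj (G n)"] deriv G0 by simp
  have bound: "\<exists>C. \<forall>z. (1 + norm z) ^ m * norm (?c * fourier_laplace (G n) z) \<le> C * exp (R * \<bar>Im z\<bar>)" for m n
  proof -
    obtain C where C: "\<And>z. (1 + norm z) ^ m * norm (fourier_laplace (G n) z) \<le> C * exp (R * \<bar>Im z\<bar>)"
      using fourier_laplace_rapidly_decreasing[OF smooth_G supp_G] R(1) by (meson less_imp_le)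
    have "(1 + norm z) ^ m * norm (?c * fourier_laplace (G n) z) \<le> (norm ?c * C) * exp (R * \<bar>Im z\<bar>)" for z
      using mult_left_mono[OF C[of z], of "norm ?c"] by (simp only: norm_mult mult_ac norm_ge_zero)
    then show ?thesis by blast
  qed
  have "fourier_adj g \<in> schwartz_space"
    unfolding schwartz_space_def
  proof (intro CollectI conjI allI smooth)
    fix m n
    obtain C where C: "\<And>z. (1 + norm z) ^ m * norm (?c * fourier_laplace (G n) z) \<le> C * exp (R * \<bar>Im z\<bar>)"
      using bound by blast
    have "\<bar>x\<bar> ^ m * norm (nth_deriv n (fourier_adj g) x) \<le> C" for x
    proof -
      have "\<bar>x\<bar> ^ m * norm (fourier_adj (G n) x) \<le> (1 + \<bar>x\<bar>) ^ m * norm (fourier_adj (G n) x)"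
        by (intro mult_right_mono power_mono) auto
      also have "\<dots> \<le> C" using C[of "of_real x"] by (simp add: fourier_adj_eq_fourier_laplace)
      finally show ?thesis unfolding nth .
    qed
    then show "\<exists>C. \<forall>x. \<bar>x\<bar> ^ m * norm (nth_deriv n (fourier_adj g) x) \<le> C" by blast
  qed
  moreover have "\<exists>C. \<forall>z. norm (?c * fourier_laplace g z) \<le> C / (1 + norm z) ^ n * exp (R * \<bar>Im z\<bar>)" for n
  proof -
    obtain C where C: "\<And>z. (1 + norm z) ^ n * norm (?c * fourier_laplace (G 0) z) \<le> C * exp (R * \<bar>Im z\<bar>)"
      using bound by blast
    have "norm (?c * fourier_laplace g z) \<le> C / (1 + norm z) ^ n * exp (R * \<bar>Im z\<bar>)" for z
    proof -
      have "0 < (1 + norm z) ^ n" by (intro zero_less_power) (use norm_ge_zero[of z] in linarith)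
      then show ?thesis using C[of z] unfolding G0 by (simp add: field_simps)
    qed
    then show ?thesis by blast
  qed
  moreover have "(\<lambda>z. ?c * fourier_laplace g z) holomorphic_on UNIV"
    using has_field_derivative_fourier_laplace[OF smooth_fun_continuous_on[OF g] R(2)]
    by (intro holomorphic_intros) (auto simp: holomorphic_on_def field_differentiable_def)
  ultimately show ?thesis
    using R(1) unfolding Z_space_def
    by (intro CollectI conjI exI[of _ "\<lambda>z. ?c * fourier_laplace g z"] exI[of _ R])
       (auto simp: fourier_adj_eq_fourier_laplace)
qed

section \<open>Fourier transforms of functions in \<open>Z_space\<close>\<close>

lemma integrable_inverse_1_plus_square_lborel: "integrable lborel (\<lambda>x::real. c / (1 + x\<^sup>2))"
proof -
  have "integrable lborel (\<lambda>x::real. c * inverse (1 + x\<^sup>2))"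
    using integrable_inverse_1_plus_square by (intro integrable_mult_right) (simp add: set_integrable_def)
  then show ?thesis by (simp add: divide_inverse)
qed

lemma integrable_of_quadratic_decay:
  fixes f :: "real \<Rightarrow> complex"
  assumes "continuous_on UNIV f" and "\<And>x. norm (f x) \<le> C / (1 + x\<^sup>2)"
  shows "integrable lborel f"
proof (rule Bochner_Integration.integrable_bound)
  show "integrable lborel (\<lambda>x::real. C / (1 + x\<^sup>2))"
    by (rule integrable_inverse_1_plus_square_lborel)
  show "f \<in> borel_measurable lborel"
    using borel_measurable_continuous_onI[OF assms(1)] by simp
  show "AE x in lborel. norm (f x) \<le> norm (C / (1 + x\<^sup>2))"
    using assms(2) by (intro AE_I2) (metis abs_ge_self order_trans real_norm_def)
qed

lemma integral_Icc_tendsto: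
  fixes f :: "real \<Rightarrow> complex"
  assumes f: "integrable lborel f"
  shows "(\<lambda>n. integral {- real n..real n} f) \<longlonglongrightarrow> (LINT x|lborel. f x)"
proof -
  note [measurable] = borel_measurable_integrable[OF f]
  have "(\<lambda>n. LINT x|lborel. indicator {- real n..real n} x *\<^sub>R f x) \<longlonglongrightarrow> (LINT x|lborel. f x)"
  proof (rule integral_dominated_convergence[where w = "\<lambda>x. norm (f x)"])
    show "AE x in lborel. (\<lambda>n. indicator {- real n..real n} x *\<^sub>R f x) \<longlonglongrightarrow> f x"
    proof (rule AE_I2)
      fix x :: real
      obtain N where N: "\<bar>x\<bar> \<le> real N" using real_arch_simple by blast
      have "indicator {- real n..real n} x *\<^sub>R f x = f x" if "n \<ge> N" for n
        using N that by (auto simp: indicator_def abs_le_iff)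
      then show "(\<lambda>n. indicator {- real n..real n} x *\<^sub>R f x) \<longlonglongrightarrow> f x"
        by (intro tendsto_eventually eventually_sequentiallyI)
    qed
  qed (use f in \<open>auto simp: indicator_def\<close>)
  moreover have "(LINT x|lborel. indicator {- real n..real n} x *\<^sub>R f x) = integral {- real n..real n} f" for n
    using set_borel_integral_eq_integral(2)[of "{- real n..real n}" f] integrable_mult_indicator[OF _ f]
    by (simp add: set_integrable_def set_lebesgue_integral_def)
  ultimately show ?thesis by simp
qed

text \<open>An entire function has a primitive \<open>K\<close>, so no contour integral is needed:
  the truncated integrals over the two lines differ by the increments of \<open>K\<close> along the
  vertical sides at n and -n. The decay of \<open>k\<close> makes these sides O(1 / (1 +
  n^2)).\<close>

lemma integral_horizontal_shift:
  assumes hol: "k holomorphic_on UNIV"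
    and bound: "\<And>x \<eta>. \<bar>\<eta>\<bar> \<le> \<bar>y\<bar> \<Longrightarrow> norm (k (of_real x + \<i> * of_real \<eta>)) \<le> B / (1 + x\<^sup>2)"
  shows "(LINT x|lborel. k (of_real x)) = (LINT x|lborel. k (of_real x + \<i> * of_real y))"
proof -
  obtain K where K: "\<And>z. (K has_field_derivative k z) (at z)"
    using holomorphic_convex_primitive'[OF convex_UNIV open_UNIV hol] by auto
  define F where "F \<eta> = (\<lambda>x. k (of_real x + \<i> * of_real \<eta>))" for \<eta>
  have cont: "continuous_on X (F \<eta>)" for X \<eta>
    unfolding F_def
    by (rule continuous_on_compose2[OF holomorphic_on_imp_continuous_on[OF hol]]) (auto intro!: continuous_intros)
  have lim: "(\<lambda>n. integral {- real n..real n} (F \<eta>)) \<longlonglongrightarrow> (LINT x|lborel. F \<eta> x)" if "\<bar>\<eta>\<bar> \<le> \<bar>y\<bar>" for \<eta>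
    by (intro integral_Icc_tendsto integrable_of_quadratic_decay[of _ B] cont)
       (use bound that in \<open>auto simp: F_def\<close>)
  define D where "D x = K (of_real x) - K (of_real x + \<i> * of_real y)" for x :: real
  have ftc: "integral {- real n..real n} (F \<eta>)
      = K (of_real (real n) + \<i> * of_real \<eta>) - K (of_real (- real n) + \<i> * of_real \<eta>)" for n \<eta>
  proof (intro integral_unique fundamental_theorem_of_calculus)
    fix x
    have "((\<lambda>z. K (z + \<i> * of_real \<eta>)) has_field_derivative k (of_real x + \<i> * of_real \<eta>) * 1) (at (of_real x))"
      by (rule DERIV_chain2[where g = "\<lambda>z. z + \<i> * of_real \<eta>"]) (auto intro!: K derivative_eq_intros)
    then have "((\<lambda>x. K (of_real x + \<i> * of_real \<eta>)) has_vector_derivative k (of_real x + \<i> * of_real \<eta>) * 1) (at x)"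
      by (rule has_vector_derivative_real_field)
    then show "((\<lambda>x. K (of_real x + \<i> * of_real \<eta>)) has_vector_derivative F \<eta> x) (at x within {- real n..real n})"
      unfolding F_def by (simp add: has_vector_derivative_at_within)
  qed auto
  have D: "norm (D x) \<le> B * \<bar>y\<bar> / (1 + x\<^sup>2)" for x
  proof -
    let ?S = "closed_segment (complex_of_real x) (of_real x + \<i> * of_real y)"
    have "norm (D x) \<le> B / (1 + x\<^sup>2) * norm (complex_of_real x - (of_real x + \<i> * of_real y))"
      unfolding D_def
    proof (rule field_differentiable_bound[of ?S])
      show "(K has_field_derivative k z) (at z within ?S)" for z
        by (rule has_field_derivative_at_within[OF K])
      fix z assume "z \<in> ?S"
      then obtain t where t: "0 \<le> t" "t \<le> 1" "z = of_real x + \<i> * of_real (t * y)"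
        by (auto simp: in_segment scaleR_conv_of_real algebra_simps)
      then have "\<bar>t * y\<bar> \<le> \<bar>y\<bar>" by (simp add: abs_mult mult_left_le_one_le)
      then show "norm (k z) \<le> B / (1 + x\<^sup>2)" using bound[of "t * y" x] t(3) by simp
    qed auto
    then show ?thesis by (simp add: norm_mult)
  qed
  have "(\<lambda>n. integral {- real n..real n} (F 0) - integral {- real n..real n} (F y)) \<longlonglongrightarrow> 0"
  proof (rule Lim_null_comparison)
    show "\<forall>\<^sub>F n in sequentially. norm (integral {- real n..real n} (F 0) - integral {- real n..real n} (F y))
        \<le> 2 * (B * \<bar>y\<bar> / (1 + (real n)\<^sup>2))"
    proof (rule always_eventually, rule allI)
      fix n
      have "integral {- real n..real n} (F 0) - integral {- real n..real n} (F y) = D (real n) - D (- real n)"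
        unfolding ftc D_def by simp
      also have "norm \<dots> \<le> norm (D (real n)) + norm (D (- real n))" by (rule norm_triangle_ineq4)
      finally show "norm (integral {- real n..real n} (F 0) - integral {- real n..real n} (F y))
        \<le> 2 * (B * \<bar>y\<bar> / (1 + (real n)\<^sup>2))"
        using D[of "real n"] D[of "- real n"] by simp
    qed
    show "(\<lambda>n. 2 * (B * \<bar>y\<bar> / (1 + (real n)\<^sup>2))) \<longlonglongrightarrow> 0" by real_asymp
  qed
  moreover have "(\<lambda>n. integral {- real n..real n} (F 0) - integral {- real n..real n} (F y))
      \<longlonglongrightarrow> (LINT x|lborel. F 0 x) - (LINT x|lborel. F y x)"
    by (intro tendsto_diff lim) auto
  ultimately have "(LINT x|lborel. F 0 x) - (LINT x|lborel. F y x) = 0"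
    using LIMSEQ_unique by blast
  then show ?thesis by (simp add: F_def)
qed

text \<open>Here the integral extends over the whole line, so differentiation under it is done by
  dominated convergence, with a multiple of the integrable function x u(x) as majorant.\<close>

lemma has_vector_derivative_fourier:
  assumes u: "integrable lborel u" and xu: "integrable lborel (\<lambda>x. of_real x * u x)"
  shows "(fourier u has_vector_derivative fourier (\<lambda>x. - \<i> * of_real x * u x) \<xi>) (at \<xi>)"
proof -
  note [measurable] = borel_measurable_integrable[OF u] borel_measurable_integrable[OF xu]
  define e where "e x h = exp (- \<i> * complex_of_real x * of_real h)" for x h
  let ?c = "complex_of_real (1 / sqrt (2 * pi))"
  let ?v = "\<lambda>x. - \<i> * of_real x * u x"
  \<comment> \<open>The integrand of the difference quotient minus the proposed derivative; the
    lemma says that its integral tends to 0 with h.\<close>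
  define q where "q h x = u x * e x \<xi> * ((e x h - 1) / of_real h + \<i> * of_real x)" for h x
  have norm_e: "norm (e x h) = 1" for x h by (simp add: e_def)
  have e_add: "e x (h + k) = e x h * e x k" for x h k
    by (simp add: e_def exp_add[symmetric] distrib_left)
  have [measurable]: "(\<lambda>x. e x h) \<in> borel_measurable borel" for h
    unfolding e_def by measurable
  have osc: "integrable lborel (\<lambda>x. w x * e x h)" if "integrable lborel w" for w h
  proof (rule Bochner_Integration.integrable_bound[OF that])
    note [measurable] = borel_measurable_integrable[OF that]
    show "(\<lambda>x. w x * e x h) \<in> borel_measurable lborel" by measurable
  qed (simp add: norm_mult norm_e)
  have iv: "integrable lborel ?v"
    using integrable_mult_right[OF xu, of "- \<i>"] by (simp add: mult.assoc)
  have quotient: "norm (fourier u (\<xi> + h) - fourier u \<xi> - h *\<^sub>R fourier ?v \<xi>) / norm h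
      = norm (?c * (LINT x|lborel. q h x))" if "h \<noteq> 0" for h
  proof -
    have "of_real h * q h x = u x * e x (\<xi> + h) - u x * e x \<xi> - of_real h * (?v x * e x \<xi>)" for x
      using that by (simp add: q_def e_add field_simps)
    then have "(LINT x|lborel. of_real h * q h x)
        = (LINT x|lborel. u x * e x (\<xi> + h) - u x * e x \<xi> - of_real h * (?v x * e x \<xi>))" by simp
    also have "\<dots> = (LINT x|lborel. u x * e x (\<xi> + h)) - (LINT x|lborel. u x * e x \<xi>)
        - of_real h * (LINT x|lborel. ?v x * e x \<xi>)"
      by (subst Bochner_Integration.integral_diff | intro Bochner_Integration.integrable_diff osc u integrable_mult_right iv)+
         (rule arg_cong[of _ _ "\<lambda>z. _ - z"], rule integral_mult_right_zero)
    finally have "?c * (of_real h * (LINT x|lborel. q h x))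
        = ?c * (LINT x|lborel. u x * e x (\<xi> + h)) - ?c * (LINT x|lborel. u x * e x \<xi>)
          - of_real h * (?c * (LINT x|lborel. ?v x * e x \<xi>))"
      by (simp only: integral_mult_right_zero right_diff_distrib mult.left_commute)
    also have "\<dots> = fourier u (\<xi> + h) - fourier u \<xi> - h *\<^sub>R fourier ?v \<xi>"
      unfolding fourier_def e_def scaleR_conv_of_real ..
    finally have "fourier u (\<xi> + h) - fourier u \<xi> - h *\<^sub>R fourier ?v \<xi> = of_real h * (?c * (LINT x|lborel. q h x))"
      by (simp add: mult_ac)
    then show ?thesis using that by (simp add: norm_mult norm_divide)
  qed
  have "((\<lambda>h. norm (?c * (LINT x|lborel. q h x))) \<longlongrightarrow> norm (?c * (LINT x::real|lborel. 0))) (at 0)"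
  \<comment> \<open>Dominated convergence speaks of sequences, so the limit at 0 is tested along
    arbitrary null sequences avoiding 0.\<close>
  proof (intro tendsto_norm tendsto_mult tendsto_const, unfold tendsto_at_iff_sequentially o_def, intro allI impI)
    fix H :: "nat \<Rightarrow> real" assume H0: "\<forall>i. H i \<in> UNIV - {0}" and H: "H \<longlonglongrightarrow> 0"
    show "(\<lambda>n. LINT x|lborel. q (H n) x) \<longlonglongrightarrow> (LINT x::real|lborel. 0)"
    proof (rule integral_dominated_convergence[where w = "\<lambda>x. 2 * norm (of_real x * u x)"])
      show "AE x in lborel. (\<lambda>n. q (H n) x) \<longlonglongrightarrow> 0"
      proof (rule AE_I2)
        fix x
        have "((\<lambda>z. exp (- \<i> * complex_of_real x * z)) has_field_derivative
            exp (- \<i> * complex_of_real x * 0) * (- \<i> * of_real x)) (at 0)"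
          by (rule DERIV_fun_exp) (rule DERIV_cmult_Id)
        then have "((\<lambda>z. (exp (- \<i> * complex_of_real x * z) - 1) / z) \<longlongrightarrow> - \<i> * of_real x) (at 0)"
          by (simp add: has_field_derivative_iff)
        moreover have "(\<lambda>n. complex_of_real (H n)) \<longlonglongrightarrow> 0"
          using tendsto_of_real[OF H] by simp
        ultimately have "(\<lambda>n. (e x (H n) - 1) / of_real (H n)) \<longlonglongrightarrow> - \<i> * of_real x"
          using H0 unfolding tendsto_at_iff_sequentially o_def e_def by fastforce
        then have "(\<lambda>n. q (H n) x) \<longlonglongrightarrow> u x * e x \<xi> * (- \<i> * of_real x + \<i> * of_real x)"
          unfolding q_def by (intro tendsto_intros)
        then show "(\<lambda>n. q (H n) x) \<longlonglongrightarrow> 0" by simp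
      qed
      fix n
      show "AE x in lborel. norm (q (H n) x) \<le> 2 * norm (of_real x * u x)"
      proof (rule AE_I2)
        fix x
        \<comment> \<open>A chord of the unit circle is no longer than its arc, so the quotient is
          at most \<bar>x\<bar>; the term i x adds another \<bar>x\<bar>, which explains the 2 in
          the majorant.\<close>
        have "norm (e x (H n) - 1) \<le> \<bar>x\<bar> * \<bar>H n\<bar>"
        proof -
          have "norm (e x (H n) - 1) = 2 * \<bar>sin (- (x * H n) / 2)\<bar>"
            using dist_exp_i_1[of "- (x * H n)"] by (simp add: e_def mult.assoc)
          also have "\<dots> \<le> 2 * \<bar>- (x * H n) / 2\<bar>" by (intro mult_left_mono abs_sin_x_le_abs_x) auto
          finally show ?thesis by (simp add: abs_mult)
        qed
        then have "norm ((e x (H n) - 1) / of_real (H n)) \<le> \<bar>x\<bar>"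
          using H0[rule_format, of n] by (simp add: norm_divide field_simps)
        then have "norm ((e x (H n) - 1) / of_real (H n) + \<i> * of_real x) \<le> \<bar>x\<bar> + \<bar>x\<bar>"
          by (intro order_trans[OF norm_triangle_ineq] add_mono) (auto simp: norm_mult)
        then have "norm (u x) * norm ((e x (H n) - 1) / of_real (H n) + \<i> * of_real x) \<le> norm (u x) * (\<bar>x\<bar> + \<bar>x\<bar>)"
          by (intro mult_left_mono) auto
        then show "norm (q (H n) x) \<le> 2 * norm (of_real x * u x)"
          unfolding q_def norm_mult norm_e by (simp add: norm_mult mult_ac)
      qed
    qed (use xu in \<open>auto simp: q_def\<close>)
  qed
  moreover have "\<forall>\<^sub>F h in at 0. norm (fourier u (\<xi> + h) - fourier u \<xi> - h *\<^sub>R fourier ?v \<xi>) / norm h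
      = norm (?c * (LINT x|lborel. q h x))"
    unfolding eventually_at_filter by (intro always_eventually allI impI quotient)
  ultimately have "((\<lambda>h. norm (fourier u (\<xi> + h) - fourier u \<xi> - h *\<^sub>R fourier ?v \<xi>) / norm h) \<longlongrightarrow> 0) (at 0)"
    by (simp add: tendsto_cong)
  then show ?thesis
    unfolding has_vector_derivative_def has_derivative_at
    by (simp add: bounded_linear_scaleR_left)
qed

lemma Z_spaceE:
  assumes "u \<in> Z_space"
  obtains \<psi> r where "\<psi> holomorphic_on UNIV" "u = (\<lambda>x. \<psi> (of_real x))" "r > 0"
    "\<And>n. \<exists>C\<ge>0. \<forall>z. (1 + norm z) ^ n * norm (\<psi> z) \<le> C * exp (r * \<bar>Im z\<bar>)"
proof -
  from assms obtain \<psi> r where \<psi>: "\<psi> holomorphic_on UNIV" "\<And>x. \<psi> (of_real x) = u x" "r > 0"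
    "\<forall>n::nat. \<exists>C. \<forall>z. norm (\<psi> z) \<le> C / (1 + norm z) ^ n * exp (r * \<bar>Im z\<bar>)"
    unfolding Z_space_def by blast
  have "\<exists>C\<ge>0. \<forall>z. (1 + norm z) ^ n * norm (\<psi> z) \<le> C * exp (r * \<bar>Im z\<bar>)" for n
  proof -
    obtain C where C: "\<And>z. norm (\<psi> z) \<le> C / (1 + norm z) ^ n * exp (r * \<bar>Im z\<bar>)" using \<psi>(4) by blast
    have "(1 + norm z) ^ n * norm (\<psi> z) \<le> \<bar>C\<bar> * exp (r * \<bar>Im z\<bar>)" for z
    proof -
      have "0 < (1 + norm z) ^ n" by (intro zero_less_power) (use norm_ge_zero[of z] in linarith)
      then have "(1 + norm z) ^ n * norm (\<psi> z) \<le> C * exp (r * \<bar>Im z\<bar>)" using C[of z] by (simp add: field_simps)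
      also have "\<dots> \<le> \<bar>C\<bar> * exp (r * \<bar>Im z\<bar>)" by (intro mult_right_mono) auto
      finally show ?thesis .
    qed
    then show ?thesis by (intro exI[of _ "\<bar>C\<bar>"]) auto
  qed
  with \<psi> show ?thesis by (intro that[of \<psi> r]) auto
qed

lemma one_plus_square_le: "1 + (Re z)\<^sup>2 \<le> (1 + norm z)\<^sup>2"
proof -
  have "(Re z)\<^sup>2 \<le> (norm z)\<^sup>2" using abs_Re_le_cmod[of z] by (metis abs_ge_zero power2_abs power_mono)
  then show ?thesis by (simp add: power2_sum) (use norm_ge_zero[of z] in linarith)
qed

lemma Z_space_continuous: "u \<in> Z_space \<Longrightarrow> continuous_on A u"
  by (rule smooth_fun_continuous_on) (simp add: Z_space_def schwartz_space_def)

lemma Z_space_decay: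
  assumes "u \<in> Z_space"
  shows "\<exists>C\<ge>0. \<forall>x. \<bar>x\<bar> ^ n * norm (u x) \<le> C / (1 + x\<^sup>2)"
proof -
  from assms obtain \<psi> r where \<psi>: "u = (\<lambda>x. \<psi> (of_real x))"
    "\<And>n. \<exists>C\<ge>0. \<forall>z. (1 + norm z) ^ n * norm (\<psi> z) \<le> C * exp (r * \<bar>Im z\<bar>)" by (rule Z_spaceE) blast
  \<comment> \<open>Two powers beyond n pay for the integrable weight 1 / (1 + x^2).\<close>
  obtain C where C: "C \<ge> 0" "\<And>z. (1 + norm z) ^ (n + 2) * norm (\<psi> z) \<le> C * exp (r * \<bar>Im z\<bar>)"
    using \<psi>(2) by blast
  have "\<bar>x\<bar> ^ n * norm (u x) \<le> C / (1 + x\<^sup>2)" for x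
  proof -
    have "(1 + x\<^sup>2) * (\<bar>x\<bar> ^ n * norm (u x)) \<le> (1 + \<bar>x\<bar>)\<^sup>2 * ((1 + \<bar>x\<bar>) ^ n * norm (u x))"
      using one_plus_square_le[of "of_real x"] by (intro mult_mono power_mono) auto
    also have "\<dots> \<le> C" using C(2)[of "of_real x"] by (simp add: \<psi>(1) power_add power2_eq_square mult_ac)
    finally show ?thesis
      by (subst pos_le_divide_eq) (auto simp: mult_ac add_pos_nonneg)
  qed
  then show ?thesis using C(1) by blast
qed

lemma Z_space_integrable:
  assumes "u \<in> Z_space"
  shows "integrable lborel (\<lambda>x. of_real x ^ n * u x)"
proof -
  obtain C where "\<And>x. \<bar>x\<bar> ^ n * norm (u x) \<le> C / (1 + x\<^sup>2)" using Z_space_decay[OF assms] by blast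
  then show ?thesis
    by (intro integrable_of_quadratic_decay[of _ C] continuous_intros Z_space_continuous assms)
       (auto simp: norm_mult norm_power)
qed

lemma Z_space_integrable': "u \<in> Z_space \<Longrightarrow> integrable lborel u"
  using Z_space_integrable[of u 0] by simp

lemma smooth_fun_fourier:
  assumes "u \<in> Z_space"
  shows "smooth_fun (fourier u)"
proof -
  let ?D = "\<lambda>n. fourier (\<lambda>x. (- \<i> * of_real x) ^ n * u x)"
  have int: "integrable lborel (\<lambda>x. (- \<i> * of_real x) ^ n * u x)" for n
    using integrable_mult_right[OF Z_space_integrable[OF assms, of n], of "(- \<i>) ^ n"]
    by (simp only: power_mult_distrib mult.assoc)
  have "(?D n has_vector_derivative ?D (Suc n) \<xi>) (at \<xi>)" for n \<xi>
  proof -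
    \<comment> \<open>The factor i undoes the -i of the next power: i * (-i x) = x, the weight
      required by \<open>has_vector_derivative_fourier\<close>.\<close>
    have "integrable lborel (\<lambda>x. \<i> * ((- \<i> * of_real x) ^ Suc n * u x))"
      by (rule integrable_mult_right[OF int])
    then have "integrable lborel (\<lambda>x. of_real x * ((- \<i> * of_real x) ^ n * u x))"
      by (simp add: mult.assoc[symmetric])
    from has_vector_derivative_fourier[OF int this, of \<xi>] show ?thesis by (simp add: mult.assoc)
  qed
  from smooth_funI_seq[of ?D, OF this] show ?thesis by simp
qed

text \<open>Shifting the line of integration to \<open>Im z = y\<close> with \<open>y \<xi> = - \<bar>y\<bar> \<bar>\<xi>\<bar>\<close> bounds the transform by
  a multiple of \<open>exp (- (\<bar>\<xi>\<bar> - r) \<bar>y\<bar>)\<close> for every \<open>y\<close>.\<close>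

theorem fourier_in_test_functions:
  assumes "u \<in> Z_space"
  shows "fourier u \<in> test_functions"
proof -
  obtain \<psi> r where \<psi>: "\<psi> holomorphic_on UNIV" "u = (\<lambda>x. \<psi> (of_real x))" "r > 0"
    "\<And>n. \<exists>C\<ge>0. \<forall>z. (1 + norm z) ^ n * norm (\<psi> z) \<le> C * exp (r * \<bar>Im z\<bar>)"
    using Z_spaceE[OF assms] by blast
  obtain C where C: "C \<ge> 0" "\<And>z. (1 + norm z) ^ 2 * norm (\<psi> z) \<le> C * exp (r * \<bar>Im z\<bar>)"
    using \<psi>(4) by blast
  have \<psi>_bound: "norm (\<psi> z) \<le> C * exp (r * \<bar>Im z\<bar>) / (1 + (Re z)\<^sup>2)" for z
  proof -
    have "(1 + (Re z)\<^sup>2) * norm (\<psi> z) \<le> (1 + norm z)\<^sup>2 * norm (\<psi> z)"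
      by (intro mult_right_mono one_plus_square_le) auto
    also have "\<dots> \<le> C * exp (r * \<bar>Im z\<bar>)" by (rule C)
    finally show ?thesis by (subst pos_le_divide_eq) (auto simp: mult_ac add_pos_nonneg)
  qed
  have "fourier u \<xi> = 0" if \<xi>: "\<bar>\<xi>\<bar> > r" for \<xi>
  proof -
    define k where "k z = \<psi> z * exp (- \<i> * z * of_real \<xi>)" for z
    have hol: "k holomorphic_on UNIV" unfolding k_def by (intro holomorphic_intros \<psi>)
    have k_bound: "norm (k (of_real x + \<i> * of_real \<eta>)) \<le> C * exp (r * \<bar>\<eta>\<bar> + \<eta> * \<xi>) / (1 + x\<^sup>2)" for x \<eta>
    proof -
      have "norm (k (of_real x + \<i> * of_real \<eta>)) = norm (\<psi> (of_real x + \<i> * of_real \<eta>)) * exp (\<eta> * \<xi>)"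
        by (simp add: k_def norm_mult)
      also have "\<dots> \<le> C * exp (r * \<bar>\<eta>\<bar>) / (1 + x\<^sup>2) * exp (\<eta> * \<xi>)"
        using \<psi>_bound[of "of_real x + \<i> * of_real \<eta>"] by (intro mult_right_mono) auto
      finally show ?thesis by (simp add: exp_add)
    qed
    let ?I = "LINT x|lborel. k (of_real x)"
    let ?P = "LINT x::real|lborel. C / (1 + x\<^sup>2)"
    have "norm ?I \<le> exp (- ((\<bar>\<xi>\<bar> - r) * real n)) * ?P" for n
    proof -
      define y where "y = - sgn \<xi> * real n"
      have y: "\<bar>y\<bar> = real n" "y * \<xi> = - (real n * \<bar>\<xi>\<bar>)"
        using \<xi> \<psi>(3) by (auto simp: y_def abs_mult sgn_if)
      have "?I = (LINT x|lborel. k (of_real x + \<i> * of_real y))"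
      proof (rule integral_horizontal_shift[OF hol])
        \<comment> \<open>A crude bound, uniform over the strip, is enough to justify the shift; the
          sharp exponent is used afterwards, on the line Im z = y alone.\<close>
        fix x \<eta> assume "\<bar>\<eta>\<bar> \<le> \<bar>y\<bar>"
        then have "r * \<bar>\<eta>\<bar> + \<eta> * \<xi> \<le> r * \<bar>y\<bar> + \<bar>y\<bar> * \<bar>\<xi>\<bar>"
          using \<psi>(3) mult_mono[of "\<bar>\<eta>\<bar>" "\<bar>y\<bar>" "\<bar>\<xi>\<bar>" "\<bar>\<xi>\<bar>"] abs_ge_self[of "\<eta> * \<xi>"]
          by (intro add_mono mult_left_mono) (simp_all add: abs_mult)
        then have "C * exp (r * \<bar>\<eta>\<bar> + \<eta> * \<xi>) / (1 + x\<^sup>2) \<le> C * exp (r * \<bar>y\<bar> + \<bar>y\<bar> * \<bar>\<xi>\<bar>) / (1 + x\<^sup>2)"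
          using C(1) by (intro divide_right_mono mult_left_mono) auto
        with k_bound show "norm (k (of_real x + \<i> * of_real \<eta>)) \<le> C * exp (r * \<bar>y\<bar> + \<bar>y\<bar> * \<bar>\<xi>\<bar>) / (1 + x\<^sup>2)"
          by (rule order_trans)
      qed
      also have "norm \<dots> \<le> (LINT x|lborel. exp (- ((\<bar>\<xi>\<bar> - r) * real n)) * (C / (1 + x\<^sup>2)))"
      proof (rule Bochner_Integration.integral_norm_bound_integral)
        show "integrable lborel (\<lambda>x. k (of_real x + \<i> * of_real y))"
          using k_bound
          by (intro integrable_of_quadratic_decay continuous_on_compose2[OF holomorphic_on_imp_continuous_on[OF hol]])
             (auto intro!: continuous_intros)
        show "integrable lborel (\<lambda>x. exp (- ((\<bar>\<xi>\<bar> - r) * real n)) * (C / (1 + x\<^sup>2)))"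
          by (intro integrable_mult_right integrable_inverse_1_plus_square_lborel)
        show "norm (k (of_real x + \<i> * of_real y)) \<le> exp (- ((\<bar>\<xi>\<bar> - r) * real n)) * (C / (1 + x\<^sup>2))" for x
        proof -
          have "r * \<bar>y\<bar> + y * \<xi> = - ((\<bar>\<xi>\<bar> - r) * real n)" unfolding y by (simp add: algebra_simps)
          with k_bound[of x y] show ?thesis by (simp add: mult_ac)
        qed
      qed
      finally show ?thesis by (simp only: integral_mult_right_zero)
    qed
    \<comment> \<open>The integral does not depend on n while its bound decays exponentially,
      because \<bar>\<xi>\<bar> > r; hence it is 0.\<close>
    moreover have "(\<lambda>n. exp (- ((\<bar>\<xi>\<bar> - r) * real n)) * ?P) \<longlonglongrightarrow> 0 * ?P"
    proof (intro tendsto_mult tendsto_const)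
      have "\<bar>\<xi>\<bar> - r > 0" using \<xi> by simp
      then show "(\<lambda>n. exp (- ((\<bar>\<xi>\<bar> - r) * real n))) \<longlonglongrightarrow> 0" by real_asymp
    qed
    ultimately have "norm ?I \<le> 0 * ?P" by (intro LIMSEQ_le_const[where x = "0 * ?P"]) auto
    then show ?thesis by (simp add: fourier_def k_def \<psi>(2))
  qed
  with smooth_fun_fourier[OF assms] show ?thesis by (rule test_functionsI)
qed

section \<open>Fourier inversion\<close>

text \<open>The Gaussian is its own transform; this is read off from the characteristic function of
  the standard normal distribution.\<close>

lemma fourier_std_normal_density:
  "(LINT x|lborel. of_real (std_normal_density x) * exp (\<i> * of_real t * of_real x))
     = of_real (sqrt (2 * pi) * std_normal_density t)"
proof -
  have "char std_normal_distribution t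
      = (LINT x|lborel. of_real (std_normal_density x) * exp (\<i> * of_real t * of_real x))"
    unfolding char_def by (subst integral_density) (auto simp: scaleR_conv_of_real mult_ac)
  moreover have "char std_normal_distribution t = of_real (sqrt (2 * pi) * std_normal_density t)"
    unfolding char_std_normal_distribution by (simp add: std_normal_density_def)
  ultimately show ?thesis by simp
qed

text \<open>Gaussian regularisation: both sides are computed from the absolutely convergent double integral
  of \<open>N(s \<xi>) u(y) exp(i (x - y) \<xi>)\<close>, where \<open>N\<close> is the standard normal density.\<close>

theorem fourier_inversion:
  assumes u: "integrable lborel u" and cont: "continuous_on UNIV u"
    and bound: "\<And>x. norm (u x) \<le> B" and fu: "integrable lborel (fourier u)"
  shows "fourier_adj (fourier u) x = u x"
proof -
  note [measurable] = borel_measurable_integrable[OF u] borel_measurable_integrable[OF fu]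
  let ?N = "std_normal_density"
  let ?c = "complex_of_real (1 / sqrt (2 * pi))"
  have key: "(LINT \<xi>|lborel. of_real (?N (s * \<xi>)) * (fourier u \<xi> * exp (\<i> * of_real x * of_real \<xi>)))
      = (LINT w|lborel. of_real (?N w) * u (x + s * w))" if s: "s > 0" for s
  proof -
    have iN: "integrable lborel (\<lambda>\<xi>. complex_of_real (?N (s * \<xi>)))"
      using lborel_integrable_real_affine[of ?N s 0] s by (intro integrable_of_real) simp
    have "(LINT \<xi>|lborel. of_real (?N (s * \<xi>)) * (fourier u \<xi> * exp (\<i> * of_real x * of_real \<xi>)))
        = (LINT \<xi>|lborel. ?c * (LINT y|lborel. of_real (?N (s * \<xi>)) * u y * exp (\<i> * of_real (x - y) * of_real \<xi>)))"
    proof (rule Bochner_Integration.integral_cong[OF refl])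
      fix \<xi>
      have "of_real (?N (s * \<xi>)) * (fourier u \<xi> * exp (\<i> * of_real x * of_real \<xi>))
         = ?c * ((of_real (?N (s * \<xi>)) * exp (\<i> * of_real x * of_real \<xi>)) *
            (LINT y|lborel. u y * exp (- \<i> * of_real y * of_real \<xi>)))"
        by (simp add: fourier_def mult_ac)
      also have "\<dots> = ?c * (LINT y|lborel. (of_real (?N (s * \<xi>)) * exp (\<i> * of_real x * of_real \<xi>)) *
          (u y * exp (- \<i> * of_real y * of_real \<xi>)))"
        by simp
      also have "\<dots> = ?c * (LINT y|lborel. of_real (?N (s * \<xi>)) * u y * exp (\<i> * of_real (x - y) * of_real \<xi>))"
      proof -
        have "exp (\<i> * of_real (x - y) * of_real \<xi>) = exp (\<i> * of_real x * of_real \<xi>) * exp (- \<i> * of_real y * of_real \<xi>)" for y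
          by (simp add: exp_add[symmetric] algebra_simps)
        then show ?thesis by (simp only: mult_ac)
      qed
      finally show "of_real (?N (s * \<xi>)) * (fourier u \<xi> * exp (\<i> * of_real x * of_real \<xi>))
        = ?c * (LINT y|lborel. of_real (?N (s * \<xi>)) * u y * exp (\<i> * of_real (x - y) * of_real \<xi>))" .
    qed
    also have "\<dots> = ?c * (LINT \<xi>|lborel. LINT y|lborel. of_real (?N (s * \<xi>)) * u y * exp (\<i> * of_real (x - y) * of_real \<xi>))"
      by simp
    also have "\<dots> = ?c * (LINT y|lborel. LINT \<xi>|lborel. of_real (?N (s * \<xi>)) * u y * exp (\<i> * of_real (x - y) * of_real \<xi>))"
      by (subst fubini_bounded_kernel[where B = 1, OF iN u]) auto
    also have "\<dots> = (LINT y|lborel. u y * of_real (?N ((x - y) / s) / s))"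
    proof -
      \<comment> \<open>The Gaussian of width 1 / s transforms into one of width s, and the
        resulting factor sqrt (2 * pi) cancels \<open>?c\<close>.\<close>
      have "(LINT \<xi>|lborel. of_real (?N (s * \<xi>)) * u y * exp (\<i> * of_real (x - y) * of_real \<xi>))
         = u y * of_real (sqrt (2 * pi) * ?N ((x - y) / s) / s)" for y
      proof -
        have "(LINT \<xi>|lborel. of_real (?N (s * \<xi>)) * u y * exp (\<i> * of_real (x - y) * of_real \<xi>))
          = u y * (LINT \<xi>|lborel. of_real (?N (s * \<xi>)) * exp (\<i> * of_real (x - y) * of_real \<xi>))"
          by (simp add: mult_ac flip: integral_mult_right_zero)
        also have "(LINT \<xi>|lborel. of_real (?N (s * \<xi>)) * exp (\<i> * of_real (x - y) * of_real \<xi>))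
          = of_real (sqrt (2 * pi) * ?N ((x - y) / s) / s)"
        proof -
          have "exp (\<i> * of_real ((x - y) / s) * of_real (0 + s * \<xi>)) = exp (\<i> * of_real (x - y) * of_real \<xi>)" for \<xi>
            using s by (simp add: mult.assoc)
          then have "(LINT \<xi>|lborel. of_real (?N \<xi>) * exp (\<i> * of_real ((x - y) / s) * of_real \<xi>))
            = s *\<^sub>R (LINT \<xi>|lborel. of_real (?N (s * \<xi>)) * exp (\<i> * of_real (x - y) * of_real \<xi>))"
            using s
            by (subst lborel_integral_real_affine[of s _ 0]) simp_all
          then show ?thesis
            using s unfolding fourier_std_normal_density by (simp add: scaleR_conv_of_real field_simps)
        qed
        finally show ?thesis .
      qed
      then show ?thesis by (simp flip: integral_mult_right_zero)
    qed
    also have "\<dots> = s *\<^sub>R (LINT w|lborel. u (x + s * w) * of_real (?N ((x - (x + s * w)) / s) / s))"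
      using lborel_integral_real_affine[of s "\<lambda>y. u y * of_real (?N ((x - y) / s) / s)" x] s by simp
    also have "\<dots> = (LINT w|lborel. of_real (?N w) * u (x + s * w))"
    proof -
      have "?N ((x - (x + s * w)) / s) = ?N w" for w using s by (simp add: std_normal_density_def)
      then show ?thesis using s
        by (simp add: scaleR_conv_of_real flip: integral_mult_right_zero) (simp add: mult_ac)
    qed
    finally show ?thesis .
  qed
  define s where "s n = inverse (real (Suc n))" for n
  have s: "s n > 0" "s \<longlonglongrightarrow> 0" for n
    unfolding s_def by (simp, rule LIMSEQ_inverse_real_of_nat)
  have N_le: "?N y \<le> ?N 0" for y by (simp add: std_normal_density_def divide_right_mono)
  have N_cont: "isCont ?N y" for y unfolding std_normal_density_def by (intro continuous_intros) auto
  \<comment> \<open>Both sides of \<open>key\<close> are followed as s tends to 0: the left one is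
    dominated by integrability of \<open>fourier u\<close>, the right one by boundedness of
    \<open>u\<close>, with continuity giving the pointwise limit.\<close>
  have "(\<lambda>n. LINT \<xi>|lborel. of_real (?N (s n * \<xi>)) * (fourier u \<xi> * exp (\<i> * of_real x * of_real \<xi>)))
      \<longlonglongrightarrow> (LINT \<xi>|lborel. of_real (?N 0) * (fourier u \<xi> * exp (\<i> * of_real x * of_real \<xi>)))"
  proof (rule integral_dominated_convergence[where w = "\<lambda>\<xi>. ?N 0 * norm (fourier u \<xi>)"])
    show "integrable lborel (\<lambda>\<xi>. ?N 0 * norm (fourier u \<xi>))"
      using fu by (intro integrable_mult_right integrable_norm)
    show "AE \<xi> in lborel. (\<lambda>n. of_real (?N (s n * \<xi>)) * (fourier u \<xi> * exp (\<i> * of_real x * of_real \<xi>)))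
        \<longlonglongrightarrow> of_real (?N 0) * (fourier u \<xi> * exp (\<i> * of_real x * of_real \<xi>))"
    proof (intro AE_I2 tendsto_mult tendsto_const tendsto_of_real)
      fix \<xi>
      show "(\<lambda>n. ?N (s n * \<xi>)) \<longlonglongrightarrow> ?N 0"
        by (rule isCont_tendsto_compose[OF N_cont]) (use tendsto_mult_left_zero[OF s(2)] in auto)
    qed
  qed (auto simp: norm_mult N_le intro!: mult_right_mono)
  moreover have "(\<lambda>n. LINT w|lborel. of_real (?N w) * u (x + s n * w)) \<longlonglongrightarrow> (LINT w|lborel. of_real (?N w) * u x)"
  proof (rule integral_dominated_convergence[where w = "\<lambda>w. ?N w * B"])
    show "AE w in lborel. (\<lambda>n. of_real (?N w) * u (x + s n * w)) \<longlonglongrightarrow> of_real (?N w) * u x"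
    proof (intro AE_I2 tendsto_mult tendsto_const)
      fix w
      have "(\<lambda>n. x + s n * w) \<longlonglongrightarrow> x + 0 * w" by (intro tendsto_intros s)
      then have "(\<lambda>n. x + s n * w) \<longlonglongrightarrow> x" by simp
      moreover have "isCont u x" using cont by (simp add: continuous_on_eq_continuous_at)
      ultimately show "(\<lambda>n. u (x + s n * w)) \<longlonglongrightarrow> u x" by (rule isCont_tendsto_compose[rotated])
    qed
  qed (auto simp: norm_mult bound intro!: mult_left_mono)
  ultimately have "(LINT \<xi>|lborel. of_real (?N 0) * (fourier u \<xi> * exp (\<i> * of_real x * of_real \<xi>)))
      = (LINT w|lborel. of_real (?N w) * u x)"
    unfolding key[OF s(1)] using LIMSEQ_unique by blast
  also have "\<dots> = of_real (LINT w|lborel. ?N w) * u x" 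
    by (simp only: integral_mult_left_zero integral_complex_of_real)
  also have "\<dots> = u x" by simp
  \<comment> \<open>The value of the density at 0 is 1 / sqrt (2 * pi), exactly the normalisation of
    \<open>fourier_adj\<close>.\<close>
  finally show ?thesis by (simp add: fourier_adj_def std_normal_density_def)
qed

section \<open>The complex Beta integral\<close>

text \<open>The power extended by zero, so that integrals over (0, t) become convolutions on the
  whole line without side conditions on \<open>s\<close> and \<open>t - s\<close>.\<close>

definition pos_powr :: "real \<Rightarrow> complex \<Rightarrow> complex" where
  "pos_powr t z = (if t > 0 then exp (z * of_real (ln t)) else 0)"

lemma pos_powr_eq_powr: "t > 0 \<Longrightarrow> pos_powr t z = of_real t powr z"
  by (simp add: pos_powr_def powr_def Ln_of_real)

lemma pos_powr_nonpos [simp]: "t \<le> 0 \<Longrightarrow> pos_powr t z = 0"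
  by (simp add: pos_powr_def)

lemma norm_pos_powr: "norm (pos_powr t z) = (if t > 0 then t powr Re z else 0)"
  by (simp add: pos_powr_def powr_def)

lemma pos_powr_add: "pos_powr t (w + z) = pos_powr t w * pos_powr t z"
  by (simp add: pos_powr_def exp_add distrib_right)

lemma pos_powr_mult: "t > 0 \<Longrightarrow> pos_powr (t * s) z = pos_powr t z * pos_powr s z"
  by (auto simp: pos_powr_def exp_add[symmetric] ln_mult zero_less_mult_iff algebra_simps)

lemma measurable_pos_powr [measurable (raw)]:
  "f \<in> borel_measurable M \<Longrightarrow> g \<in> borel_measurable M \<Longrightarrow> (\<lambda>x. pos_powr (f x) (g x)) \<in> borel_measurable M"
  unfolding pos_powr_def by simp

text \<open>Euler's integral, carried over from the gauge integral to the Lebesgue integral, where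
  Fubini applies.\<close>

lemma has_bochner_integral_Gamma:
  assumes "Re z > 0"
  shows "has_bochner_integral lborel (\<lambda>t. pos_powr t (z - 1) * of_real (exp (- t))) (Gamma z)"
proof -
  let ?f = "\<lambda>t. complex_of_real t powr (z - 1) / of_real (exp t)"
  have eq: "(\<lambda>t. indicator {0<..} t *\<^sub>R ?f t) = (\<lambda>t. pos_powr t (z - 1) * of_real (exp (- t)))"
    by (auto simp: indicator_def fun_eq_iff pos_powr_eq_powr exp_minus field_simps)
  have "integrable lebesgue (\<lambda>t. indicator {0<..} t *\<^sub>R ?f t)"
    using absolutely_integrable_Gamma_integral'[OF assms] unfolding set_integrable_def .
  then have int: "integrable lborel (\<lambda>t. pos_powr t (z - 1) * of_real (exp (- t)))"
    unfolding eq by (subst (asm) integrable_completion) measurable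
  have "(LINT t:{0<..}|lborel. ?f t) = integral {0<..} ?f"
    using int unfolding eq[symmetric] by (intro set_borel_integral_eq_integral) (simp add: set_integrable_def)
  also have "\<dots> = Gamma z" by (intro integral_unique Gamma_integral_complex' assms)
  finally show ?thesis
    using int by (simp add: has_bochner_integral_iff set_lebesgue_integral_def eq)
qed

text \<open>For positive t, scaling s by t reduces to t = 1, where the modulus is the real Beta
  integrand; otherwise one factor always vanishes.\<close>

lemma integrable_pos_powr_convolution:
  assumes "Re a > 0" "Re b > 0"
  shows "integrable lborel (\<lambda>s. pos_powr s (a - 1) * pos_powr (t - s) (b - 1))"
proof (cases "t > 0")
  case True
  have *: "integrable lborel (\<lambda>s. pos_powr s (a - 1) * pos_powr (1 - s) (b - 1))"
  proof (rule Bochner_Integration.integrable_bound)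
    show "integrable lborel (\<lambda>s. indicator {0..1} s *\<^sub>R (s powr (Re a - 1) * (1 - s) powr (Re b - 1)))"
      using integrable_Beta[OF assms] by (simp add: set_integrable_def)
  qed (auto simp: norm_mult norm_pos_powr indicator_def)
  have "integrable lborel (\<lambda>s. pos_powr t (a - 1) * pos_powr t (b - 1) *
      (pos_powr (0 + (1/t) * s) (a - 1) * pos_powr (1 - (0 + (1/t) * s)) (b - 1)))"
    using lborel_integrable_real_affine[OF *, of "1/t" 0] True by (intro integrable_mult_right) auto
  also have "(\<lambda>s. pos_powr t (a - 1) * pos_powr t (b - 1) *
      (pos_powr (0 + (1/t) * s) (a - 1) * pos_powr (1 - (0 + (1/t) * s)) (b - 1)))
    = (\<lambda>s. pos_powr s (a - 1) * pos_powr (t - s) (b - 1))"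
  proof
    fix s
    have "pos_powr s (a - 1) = pos_powr t (a - 1) * pos_powr (s / t) (a - 1)"
      using pos_powr_mult[OF True, of "s / t"] True by simp
    moreover have "pos_powr (t - s) (b - 1) = pos_powr t (b - 1) * pos_powr (1 - s / t) (b - 1)"
      using pos_powr_mult[OF True, of "1 - s / t"] True by (simp add: right_diff_distrib)
    ultimately show "pos_powr t (a - 1) * pos_powr t (b - 1) *
      (pos_powr (0 + (1/t) * s) (a - 1) * pos_powr (1 - (0 + (1/t) * s)) (b - 1))
      = pos_powr s (a - 1) * pos_powr (t - s) (b - 1)" by simp
  qed
  finally show ?thesis .
next
  case False
  then have "(\<lambda>s. pos_powr s (a - 1) * pos_powr (t - s) (b - 1)) = (\<lambda>s. 0)"
    by (auto simp: pos_powr_def fun_eq_iff)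
  then show ?thesis by simp
qed

text \<open>Fubini for shifted factors. The factor q (t - s) may be unbounded, so
  \<open>fubini_bounded_kernel\<close> does not apply; translation invariance gives the
  integrability instead.\<close>

lemma integral_convolution:
  fixes p q :: "real \<Rightarrow> complex"
  assumes p: "integrable lborel p" and q: "integrable lborel q"
  shows "(LINT t|lborel. LINT s|lborel. p s * q (t - s)) = (LINT s|lborel. p s) * (LINT s|lborel. q s)"
proof -
  note [measurable] = borel_measurable_integrable[OF p] borel_measurable_integrable[OF q]
  have shift: "(LINT t|lborel. f (t - s)) = (LINT t|lborel. f t)"
    for f :: "real \<Rightarrow> 'b::{banach, second_countable_topology}" and s
    using lborel_integral_real_affine[of 1 f "-s"] by simp
  have int_shift: "integrable lborel (\<lambda>t. q (t - s))" for s
    using lborel_integrable_real_affine[OF q, of 1 "-s"] by simp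
  have "integrable (lborel \<Otimes>\<^sub>M lborel) (\<lambda>(s, t). p s * q (t - s))"
  proof (rule lborel_pair.Fubini_integrable)
    have "integrable lborel (\<lambda>s. norm (p s) * (LINT t|lborel. norm (q t)))"
      using p by (intro integrable_mult_left integrable_norm)
    then show "integrable lborel (\<lambda>s. LINT t|lborel. norm (case (s, t) of (s, t) \<Rightarrow> p s * q (t - s)))"
      using shift[of "\<lambda>x. norm (q x)"] by (simp add: norm_mult)
    show "AE s in lborel. integrable lborel (\<lambda>t. case (s, t) of (s, t) \<Rightarrow> p s * q (t - s))"
      using int_shift by auto
  qed measurable
  from lborel_pair.Fubini_integral[OF this]
  have "(LINT t|lborel. LINT s|lborel. p s * q (t - s)) = (LINT s|lborel. LINT t|lborel. p s * q (t - s))" .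
  then show ?thesis by (simp add: shift)
qed

text \<open>Homogeneity determines the dependence on t up to a constant \<open>c\<close>. Weighting
  with exp (- t) and integrating over t makes the convolution a product of two Gamma integrals, so
  Gamma a * Gamma b = Gamma (a + b) * c identifies \<open>c\<close>.\<close>

theorem complex_Beta_integral:
  assumes "Re a > 0" "Re b > 0"
  shows "(LINT s|lborel. pos_powr s (a - 1) * pos_powr (t - s) (b - 1))
       = pos_powr t (a + b - 1) * Beta a b"
proof -
  define c where "c = (LINT s|lborel. pos_powr s (a - 1) * pos_powr (1 - s) (b - 1))"
  have scale: "(LINT s|lborel. pos_powr s (a - 1) * pos_powr (t - s) (b - 1)) = pos_powr t (a + b - 1) * c" for t
  proof (cases "t > 0")
    case True
    have "(LINT s|lborel. pos_powr s (a - 1) * pos_powr (t - s) (b - 1))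
        = t *\<^sub>R (LINT s|lborel. pos_powr (t * s) (a - 1) * pos_powr (t * (1 - s)) (b - 1))"
      using lborel_integral_real_affine[of t "\<lambda>s. pos_powr s (a - 1) * pos_powr (t - s) (b - 1)" 0] True
      by (simp add: right_diff_distrib)
    also have "\<dots> = t *\<^sub>R (LINT s|lborel. (pos_powr t (a - 1) * pos_powr t (b - 1)) *
        (pos_powr s (a - 1) * pos_powr (1 - s) (b - 1)))"
      unfolding pos_powr_mult[OF True] by (simp only: mult_ac)
    also have "\<dots> = pos_powr t 1 * pos_powr t (a - 1) * pos_powr t (b - 1) * c"
      using True by (simp add: c_def scaleR_conv_of_real pos_powr_eq_powr)
    also have "\<dots> = pos_powr t (a + b - 1) * c"
      by (simp add: pos_powr_add[symmetric] algebra_simps)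
    finally show ?thesis .
  next
    case False
    then have *: "(\<lambda>s. pos_powr s (a - 1) * pos_powr (t - s) (b - 1)) = (\<lambda>s. 0)"
      by (auto simp: pos_powr_def fun_eq_iff)
    show ?thesis unfolding * using False by simp
  qed
  let ?p = "\<lambda>z t. pos_powr t (z - 1) * of_real (exp (- t))"
  have "Gamma a * Gamma b = (LINT t|lborel. LINT s|lborel. ?p a s * ?p b (t - s))"
    using has_bochner_integral_Gamma[OF assms(1)] has_bochner_integral_Gamma[OF assms(2)]
    by (subst integral_convolution) (auto simp: has_bochner_integral_iff)
  also have "\<dots> = (LINT t|lborel. LINT s|lborel. of_real (exp (-t)) * (pos_powr s (a - 1) * pos_powr (t - s) (b - 1)))"
    by (intro Bochner_Integration.integral_cong refl)
       (simp add: exp_diff exp_minus of_real_divide of_real_inverse field_simps)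
  also have "\<dots> = (LINT t|lborel. ?p (a + b) t * c)"
    by (simp add: scale mult_ac)
  also have "\<dots> = Gamma (a + b) * c"
    using has_bochner_integral_Gamma[of "a + b"] assms by (simp add: has_bochner_integral_iff)
  finally have *: "Gamma a * Gamma b = Gamma (a + b) * c" .
  \<comment> \<open>By convention \<open>Gamma\<close> takes the value 0 precisely at its poles, so
    excluding these is what allows the division.\<close>
  have "a + b \<notin> \<int>\<^sub>\<le>\<^sub>0"
    using assms by (auto elim!: nonpos_Ints_cases dest!: arg_cong[of "a + b" _ Re])
  then have "Gamma (a + b) \<noteq> 0" by (simp add: Gamma_eq_zero_iff)
  with * have "c = Beta a b" by (simp add: Beta_def field_simps)
  with scale show ?thesis by simp
qed

section \<open>Mellin superpositions and their Laplace convolution\<close>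

lemma smooth_fun_rGamma: "smooth_fun (\<lambda>\<xi>. inverse (Gamma (1 + \<i> * of_real \<xi>)))"
  unfolding rGamma_inverse_Gamma[symmetric]
  by (rule smooth_fun_holomorphic[OF holomorphic_rGamma open_UNIV]) simp

text \<open>The line Re z = 1/2 stays in the half-plane free of poles, so the factor in
  \<open>Xi_map\<close> keeps test functions; the reciprocal in \<open>b_function\<close> does so
  because 1 / \<open>Gamma\<close> is entire.\<close>

lemma smooth_fun_Gamma: "smooth_fun (\<lambda>\<xi>. Gamma (1 / 2 + \<i> * of_real \<xi>))"
proof (rule smooth_fun_holomorphic)
  show "Gamma holomorphic_on {z. Re z > 0}"
    by (intro holomorphic_Gamma) (auto elim!: nonpos_Ints_cases)
  show "open {z. Re z > 0}" by (rule open_halfspace_Re_gt)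
qed simp

lemma test_functions_mult_smooth:
  assumes "smooth_fun a" "g \<in> test_functions"
  shows "(\<lambda>x. a x * g x) \<in> test_functions"
proof -
  obtain R where "\<And>x. \<bar>x\<bar> > R \<Longrightarrow> g x = 0" using test_functionsE[OF assms(2)] by blast
  then show ?thesis
    by (intro test_functionsI[of _ R] smooth_fun_mult assms(1) test_functions_smooth[OF assms(2)]) simp
qed

lemma test_functions_reflect_cnj:
  assumes "g \<in> test_functions"
  shows "reflect (\<lambda>\<xi>. cnj (g \<xi>)) \<in> test_functions"
proof -
  obtain R where R: "\<And>x. \<bar>x\<bar> > R \<Longrightarrow> g x = 0" using test_functionsE[OF assms] by blast
  have "smooth_fun (reflect (\<lambda>\<xi>. cnj (g \<xi>)))"
  proof (rule smooth_fun_coinduct)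
    \<comment> \<open>The scalar \<open>c\<close> absorbs the sign produced by differentiating x
      \<mapsto> -x.\<close>
    let ?S = "{\<lambda>x. c * cnj (v (- x)) |c v. smooth_fun v}"
    show "reflect (\<lambda>\<xi>. cnj (g \<xi>)) \<in> ?S"
      using test_functions_smooth[OF assms]
      by (auto simp: reflect_def fun_eq_iff intro!: exI[of _ 1] exI[of _ g])
    fix w assume "w \<in> ?S"
    then obtain c v where w: "w = (\<lambda>x. c * cnj (v (- x)))" and v: "smooth_fun v" by blast
    show "\<exists>w'\<in>?S. \<forall>x. (w has_vector_derivative w' x) (at x)"
    proof (intro bexI allI)
      fix x
      have "((\<lambda>x. v (- x)) has_vector_derivative (- 1) *\<^sub>R nth_deriv (Suc 0) v (- x)) (at x)"
      proof -
        have "(uminus has_vector_derivative - 1) (at x)"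
          unfolding has_real_derivative_iff_has_vector_derivative[symmetric] by (rule derivative_eq_intros refl)+
        from vector_diff_chain_at[OF this has_vector_derivative_nth_deriv[OF v, of 0, unfolded nth_deriv_0]]
        show ?thesis by (simp add: o_def)
      qed
      then have "((\<lambda>x. c * cnj (v (- x))) has_vector_derivative c * cnj ((- 1) *\<^sub>R nth_deriv (Suc 0) v (- x))) (at x)"
        by (intro has_vector_derivative_mult_right has_vector_derivative_cnj)
      then show "(w has_vector_derivative - c * cnj (nth_deriv (Suc 0) v (- x))) (at x)"
        unfolding w by simp
    qed (use smooth_fun_nth_deriv[OF v] in blast)
  qed
  then show ?thesis by (rule test_functionsI[of _ R]) (simp add: reflect_def R)
qed

lemma convol_in_test_functions:
  assumes "u \<in> test_functions" "v \<in> test_functions"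
  shows "convol u v \<in> test_functions"
proof -
  obtain R where R: "\<And>x. \<bar>x\<bar> > R \<Longrightarrow> v x = 0" using test_functionsE[OF assms(2)] by blast
  obtain R' where R': "\<And>x. \<bar>x\<bar> > R' \<Longrightarrow> u x = 0" using test_functionsE[OF assms(1)] by blast
  have v: "continuous_on X v" for X
    by (intro smooth_fun_continuous_on test_functions_smooth assms)
  have eq: "convol w v \<xi> = integral (cbox (-R) R) (\<lambda>\<eta>. w (\<xi> - \<eta>) * v \<eta>)" if "smooth_fun w" for w \<xi>
    unfolding convol_def box_real
    by (rule lborel_integral_vanishing_outside)
       (auto intro!: continuous_intros v continuous_on_compose2[OF smooth_fun_continuous_on[OF that, of UNIV]] simp: R)
  have "smooth_fun (convol u v)"
  proof (rule smooth_fun_coinduct)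
    \<comment> \<open>All derivatives fall on the first factor; \<open>v\<close> stays fixed and
      keeps the interval of integration compact, so \<open>w\<close> need only be smooth.\<close>
    let ?S = "{convol w v |w. smooth_fun w}"
    show "convol u v \<in> ?S" using test_functions_smooth[OF assms(1)] by blast
    fix f assume "f \<in> ?S"
    then obtain w where f: "f = convol w v" and w: "smooth_fun w" by blast
    let ?w' = "nth_deriv (Suc 0) w"
    have w': "smooth_fun ?w'" by (rule smooth_fun_nth_deriv[OF w])
    show "\<exists>g\<in>?S. \<forall>x. (f has_vector_derivative g x) (at x)"
    proof (intro bexI allI)
      fix \<xi>
      have "((\<lambda>\<xi>. integral (cbox (-R) R) (\<lambda>\<eta>. w (\<xi> - \<eta>) * v \<eta>)) has_vector_derivative
          integral (cbox (-R) R) (\<lambda>\<eta>. ?w' (\<xi> - \<eta>) * v \<eta>)) (at \<xi> within UNIV)"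
      proof (rule leibniz_rule_vector_derivative)
        fix \<xi> \<eta>
        have "((\<lambda>\<xi>. w (\<xi> - \<eta>)) has_vector_derivative 1 *\<^sub>R ?w' (\<xi> - \<eta>)) (at \<xi>)"
        proof -
          have "((\<lambda>\<xi>. \<xi> - \<eta>) has_vector_derivative 1) (at \<xi>)"
            unfolding has_real_derivative_iff_has_vector_derivative[symmetric] by (auto intro!: derivative_eq_intros)
          from vector_diff_chain_at[OF this has_vector_derivative_nth_deriv[OF w, of 0, unfolded nth_deriv_0]]
          show ?thesis by (simp add: o_def)
        qed
        then show "((\<lambda>\<xi>. w (\<xi> - \<eta>) * v \<eta>) has_vector_derivative ?w' (\<xi> - \<eta>) * v \<eta>) (at \<xi> within UNIV)"
          by (intro has_vector_derivative_mult_left) simp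
        show "(\<lambda>\<eta>. w (\<xi> - \<eta>) * v \<eta>) integrable_on cbox (-R) R"
          by (intro integrable_continuous continuous_intros v
              continuous_on_compose2[OF smooth_fun_continuous_on[OF w, of UNIV]]) auto
      next
        show "continuous_on (UNIV \<times> cbox (- R) R) (\<lambda>(\<xi>, \<eta>). ?w' (\<xi> - \<eta>) * v \<eta>)"
          unfolding split_beta
          by (intro continuous_intros continuous_on_compose2[OF smooth_fun_continuous_on[OF w', of UNIV]]
              continuous_on_compose2[OF v[of UNIV]]) auto
      qed auto
      then show "(f has_vector_derivative convol ?w' v \<xi>) (at \<xi>)"
        unfolding f eq[OF w, abs_def] eq[OF w'] by simp
    qed (use w' in blast)
  qed
  moreover have "convol u v \<xi> = 0" if "\<bar>\<xi>\<bar> > R + R'" for \<xi>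
  proof -
    have "u (\<xi> - \<eta>) * v \<eta> = 0" for \<eta>
      using that R[of \<eta>] R'[of "\<xi> - \<eta>"] by (cases "\<bar>\<eta>\<bar> > R") auto
    then have "(\<lambda>\<eta>. u (\<xi> - \<eta>) * v \<eta>) = (\<lambda>_. 0)" by (rule ext)
    then show ?thesis unfolding convol_def by simp
  qed
  ultimately show ?thesis by (rule test_functionsI)
qed

text \<open>The substitution \<zeta> = \<xi> + \<eta> followed by an interchange: this collects the
  frequencies of the two superpositions.\<close>

lemma integral_convol:
  assumes u: "u \<in> test_functions" and v: "v \<in> test_functions" and K: "continuous_on UNIV K"
  shows "(LINT \<eta>|lborel. v \<eta> * (LINT \<xi>|lborel. u \<xi> * K (\<xi> + \<eta>))) = (LINT \<zeta>|lborel. K \<zeta> * convol u v \<zeta>)"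
proof -
  obtain R where R: "\<And>x. \<bar>x\<bar> > R \<Longrightarrow> v x = 0" using test_functionsE[OF v] by blast
  obtain R' where R': "\<And>x. \<bar>x\<bar> > R' \<Longrightarrow> u x = 0" using test_functionsE[OF u] by blast
  have uc: "continuous_on UNIV u" and vc: "continuous_on UNIV v"
    by (intro smooth_fun_continuous_on test_functions_smooth u v)+
  obtain B where B: "\<And>x. norm (u x) \<le> B"
    using continuous_vanishing_outside_bounded[OF uc R'] by blast
  have [measurable]: "u \<in> borel_measurable borel"
    by (rule borel_measurable_continuous_onI[OF uc])
  \<comment> \<open>\<open>K\<close> is merely continuous. Truncated to the interval that contains
    every sum \<xi> + \<eta> of support points it becomes integrable, and \<open>u\<close> can act
    as the bounded kernel.\<close>
  define L where "L \<zeta> = indicator {- (R + R')..R + R'} \<zeta> *\<^sub>R K \<zeta>" for \<zeta>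
  have L: "integrable lborel L"
    using borel_integrable_atLeastAtMost'[OF continuous_on_subset[OF K]]
    unfolding L_def set_integrable_def by simp
  have cut: "v \<eta> * u (\<zeta> - \<eta>) * K \<zeta> = v \<eta> * L \<zeta> * u (\<zeta> - \<eta>)" for \<zeta> \<eta>
  proof (cases "\<bar>\<eta>\<bar> > R \<or> \<bar>\<zeta> - \<eta>\<bar> > R'")
    case False
    then have "\<zeta> \<in> {- (R + R')..R + R'}" by auto
    then show ?thesis by (simp add: L_def)
  qed (auto simp: R R')
  have "(LINT \<xi>|lborel. u \<xi> * K (\<xi> + \<eta>)) = (LINT \<zeta>|lborel. u (\<zeta> - \<eta>) * K \<zeta>)" for \<eta>
    using lborel_integral_real_affine[of 1 "\<lambda>\<xi>. u \<xi> * K (\<xi> + \<eta>)" "- \<eta>"] by simp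
  then have "(LINT \<eta>|lborel. v \<eta> * (LINT \<xi>|lborel. u \<xi> * K (\<xi> + \<eta>)))
      = (LINT \<eta>|lborel. LINT \<zeta>|lborel. v \<eta> * u (\<zeta> - \<eta>) * K \<zeta>)"
    by (simp add: mult.assoc)
  also have "\<dots> = (LINT \<zeta>|lborel. LINT \<eta>|lborel. v \<eta> * L \<zeta> * u (\<zeta> - \<eta>))"
    unfolding cut
    by (rule fubini_bounded_kernel[OF continuous_vanishing_outside_integrable[OF vc R] L _ B]) measurable
  also have "\<dots> = (LINT \<zeta>|lborel. K \<zeta> * convol u v \<zeta>)"
    unfolding cut[symmetric] convol_def integral_mult_right_zero[symmetric] by (simp only: mult_ac)
  finally show ?thesis .
qed

section \<open>The Mellin transform on \<open>D_space\<close> and its inversion\<close>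

lemma integral_log_substitution:
  fixes w :: "real \<Rightarrow> complex"
  assumes cont: "continuous_on UNIV w" and w: "integrable lborel w"
  shows "(LINT t:{0<..}|lborel. (1 / t) *\<^sub>R w (ln t)) = (LINT x|lborel. w x)"
proof -
  define F where "F t = (1 / t) *\<^sub>R w (ln t)" for t :: real
  have F: "exp x *\<^sub>R F (exp x) = w x" for x by (simp add: F_def)
  have contF: "isCont F (exp x)" for x
  proof -
    have "isCont w (ln (exp x))" using cont by (simp add: continuous_on_eq_continuous_at)
    then have "isCont (\<lambda>t. w (ln t)) (exp x)" by (rule isCont_o2[rotated]) (rule isCont_ln, simp)
    then show ?thesis unfolding F_def by (intro continuous_intros) simp_all
  qed
  have lims: "((ereal \<circ> exp \<circ> real_of_ereal) \<longlongrightarrow> 0) (at_right (- \<infinity>))"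
    "((ereal \<circ> exp \<circ> real_of_ereal) \<longlongrightarrow> \<infinity>) (at_left \<infinity>)"
    unfolding zero_ereal_def ereal_tendsto_simps
    by (simp_all add: exp_at_bot exp_at_top)
  have [measurable]: "w \<in> borel_measurable borel" by (rule borel_measurable_continuous_onI[OF cont])
  have ivl: "einterval (- \<infinity>) \<infinity> = UNIV" "einterval 0 \<infinity> = {0<..}"
    by (auto simp: einterval_def zero_ereal_def)
  \<comment> \<open>The substitution rule for complex integrands presupposes integrability on both
    sides; the nonnegative rule, applied to the norm, supplies it.\<close>
  have "set_integrable lborel (einterval 0 \<infinity>) (\<lambda>t. norm (F t))"
  proof (rule interval_integral_substitution_nonneg(1)[where g = exp and g' = exp and a = "- \<infinity>" and b = \<infinity>])
    show "set_integrable lborel (einterval (- \<infinity>) \<infinity>) (\<lambda>x. norm (F (exp x)) * exp x)"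
      using integrable_norm[OF w] by (simp add: ivl set_integrable_def F_def)
  qed (use contF lims in \<open>auto intro!: derivative_eq_intros continuous_intros\<close>)
  moreover have "(\<lambda>t. indicator {0<..} t *\<^sub>R F t) \<in> borel_measurable lborel"
    unfolding F_def by measurable
  ultimately have "set_integrable lborel (einterval 0 \<infinity>) F"
    unfolding set_integrable_def ivl by (subst integrable_norm_iff[symmetric]) simp_all
  then have "(LBINT t=0..\<infinity>. F t) = (LBINT x=-\<infinity>..\<infinity>. exp x *\<^sub>R F (exp x))"
    by (intro interval_integral_substitution_integrable[where g = exp])
       (use contF lims w in \<open>auto intro!: derivative_eq_intros continuous_intros simp: F ivl set_integrable_def\<close>)
  then show ?thesis
    by (simp add: F ivl interval_lebesgue_integral_def set_lebesgue_integral_def F_def)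
qed

lemma D_space_eq:
  assumes "f \<in> D_space"
  shows "f t = pos_powr t (- 1 / 2) * (of_real (exp (ln t / 2)) * f (exp (ln t)))"
proof (cases "t > 0")
  case True
  then have "pos_powr t (- 1 / 2) * of_real (exp (ln t / 2)) = 1"
    by (simp add: pos_powr_def exp_of_real[symmetric] exp_add[symmetric])
  then show ?thesis using True by (simp add: mult.assoc[symmetric])
qed (use assms in \<open>simp add: D_space_def\<close>)

lemma mellin_eq_fourier:
  assumes "f \<in> D_space"
  shows "mellin f = fourier (\<lambda>x. of_real (exp (x / 2)) * f (exp x))"
proof
  fix \<xi>
  let ?u = "\<lambda>x. of_real (exp (x / 2)) * f (exp x)"
  have u: "?u \<in> Z_space" using assms by (simp add: D_space_def)
  let ?w = "\<lambda>x. ?u x * exp (- \<i> * of_real x * of_real \<xi>)"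
  have "f t * of_real t powr (- 1 / 2 - \<i> * of_real \<xi>) = (1 / t) *\<^sub>R ?w (ln t)" if "t > 0" for t
  proof -
    \<comment> \<open>One power -1/2 comes from writing \<open>f\<close> through \<open>?u\<close>,
      the other from the Mellin kernel; together they form the Jacobian 1 / t of x = ln t.\<close>
    have "pos_powr t (- 1 / 2) * pos_powr t (- 1 / 2 - \<i> * of_real \<xi>)
        = pos_powr t (- 1 + - \<i> * of_real \<xi>)"
    proof -
      have "- 1 + - \<i> * complex_of_real \<xi> = - 1 / 2 + (- 1 / 2 - \<i> * of_real \<xi>)"
        by (simp add: complex_eq_iff)
      then show ?thesis by (simp only: pos_powr_add[symmetric])
    qed
    also have "\<dots> = of_real (1 / t) * exp (- \<i> * of_real (ln t) * of_real \<xi>)"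
    proof -
      have "pos_powr t (- 1) = of_real (1 / t)"
        using that by (simp add: pos_powr_def exp_minus exp_of_real inverse_eq_divide)
      moreover have "pos_powr t (- \<i> * of_real \<xi>) = exp (- \<i> * of_real (ln t) * of_real \<xi>)"
        using that by (simp add: pos_powr_def mult_ac)
      ultimately show ?thesis unfolding pos_powr_add by simp
    qed
    finally have "f t * pos_powr t (- 1 / 2 - \<i> * of_real \<xi>)
        = ?u (ln t) * (of_real (1 / t) * exp (- \<i> * of_real (ln t) * of_real \<xi>))"
      by (subst D_space_eq[OF assms]) (simp only: mult_ac)
    then show ?thesis using that by (simp add: pos_powr_eq_powr scaleR_conv_of_real mult_ac)
  qed
  then have "(LINT t:{0<..}|lborel. f t * of_real t powr (- 1 / 2 - \<i> * of_real \<xi>))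
      = (LINT t:{0<..}|lborel. (1 / t) *\<^sub>R ?w (ln t))"
    by (intro set_lebesgue_integral_cong) auto
  also have "\<dots> = (LINT x|lborel. ?w x)"
  proof (rule integral_log_substitution)
    show "continuous_on UNIV ?w"
      by (intro continuous_intros Z_space_continuous[OF u])
    show "integrable lborel ?w"
      by (rule Bochner_Integration.integrable_bound[OF Z_space_integrable'[OF u]])
         (use borel_measurable_integrable[OF Z_space_integrable'[OF u]] in \<open>measurable, simp add: norm_mult\<close>)
  qed
  finally show "mellin f \<xi> = fourier ?u \<xi>" by (simp add: mellin_def fourier_def)
qed

lemma mellin_in_test_functions:
  assumes "f \<in> D_space"
  shows "mellin f \<in> test_functions"
  unfolding mellin_eq_fourier[OF assms]
  using assms by (intro fourier_in_test_functions) (simp add: D_space_def)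

lemma test_functions_integrable:
  assumes "g \<in> test_functions"
  shows "integrable lborel g"
proof -
  obtain R where "\<And>x. \<bar>x\<bar> > R \<Longrightarrow> g x = 0" using test_functionsE[OF assms] by blast
  then show ?thesis
    by (intro continuous_vanishing_outside_integrable[of g R] smooth_fun_continuous_on
        test_functions_smooth[OF assms])
qed

text \<open>Fourier inversion for \<open>?u\<close> at ln t, multiplied by t powr (-1/2). For t
  \<le> 0 both sides vanish by the zero extensions.\<close>

lemma mellin_inversion:
  assumes "f \<in> D_space"
  shows "f t = (LINT \<xi>|lborel. of_real (1 / sqrt (2 * pi)) * mellin f \<xi> * pos_powr t (- 1 / 2 + \<i> * of_real \<xi>))"
proof -
  let ?u = "\<lambda>x. of_real (exp (x / 2)) * f (exp x)"
  have u: "?u \<in> Z_space" using assms by (simp add: D_space_def)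
  obtain B where B: "\<And>x. norm (?u x) \<le> B"
  proof -
    obtain C where C: "C \<ge> 0" "\<And>x. \<bar>x\<bar> ^ 0 * norm (?u x) \<le> C / (1 + x\<^sup>2)"
      using Z_space_decay[OF u] by blast
    have "norm (?u x) \<le> C" for x
    proof -
      have "norm (?u x) \<le> C / (1 + x\<^sup>2)" using C(2)[of x] by (simp only: power_0 mult_1)
      also have "\<dots> \<le> C / 1" by (rule divide_left_mono) (use C(1) in \<open>auto simp: add_pos_nonneg\<close>)
      finally show ?thesis by (simp only: div_by_1)
    qed
    then show ?thesis by (rule that)
  qed
  have inv: "fourier_adj (fourier ?u) x = ?u x" for x
    by (rule fourier_inversion[OF Z_space_integrable'[OF u] Z_space_continuous[OF u] B
        test_functions_integrable[OF fourier_in_test_functions[OF u]]])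
  have "f t = pos_powr t (- 1 / 2) * ?u (ln t)" by (rule D_space_eq[OF assms])
  also have "\<dots> = pos_powr t (- 1 / 2) * fourier_adj (mellin f) (ln t)"
    by (simp only: inv mellin_eq_fourier[OF assms])
  also have "\<dots> = (LINT \<xi>|lborel. pos_powr t (- 1 / 2) * (of_real (1 / sqrt (2 * pi)) *
      (mellin f \<xi> * exp (\<i> * of_real (ln t) * of_real \<xi>))))"
    unfolding fourier_adj_def by simp
  also have "\<dots> = (LINT \<xi>|lborel. of_real (1 / sqrt (2 * pi)) * mellin f \<xi> * pos_powr t (- 1 / 2 + \<i> * of_real \<xi>))"
  proof (rule Bochner_Integration.integral_cong[OF refl])
    fix \<xi>
    have "pos_powr t (- 1 / 2 + \<i> * of_real \<xi>) = pos_powr t (- 1 / 2) * exp (\<i> * of_real (ln t) * of_real \<xi>)"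
      unfolding pos_powr_add by (simp add: pos_powr_def mult_ac)
    then show "pos_powr t (- 1 / 2) * (of_real (1 / sqrt (2 * pi)) * (mellin f \<xi> * exp (\<i> * of_real (ln t) * of_real \<xi>)))
        = of_real (1 / sqrt (2 * pi)) * mellin f \<xi> * pos_powr t (- 1 / 2 + \<i> * of_real \<xi>)"
      by (simp only: mult_ac)
  qed
  finally show ?thesis .
qed

section \<open>Laplace convolution of Mellin superpositions\<close>

lemma convolution_mellin_superposition:
  assumes \<phi>: "integrable lborel \<phi>"
    and w: "integrable lborel (\<lambda>s. w s * pos_powr (t - s) (- 1 / 2))"
  shows "(LINT s|lborel. w s * (LINT \<eta>|lborel. \<phi> \<eta> * pos_powr (t - s) (- 1 / 2 + \<i> * of_real \<eta>)))
      = (LINT \<eta>|lborel. \<phi> \<eta> * (LINT s|lborel. w s * pos_powr (t - s) (- 1 / 2 + \<i> * of_real \<eta>)))"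
proof -
  \<comment> \<open>The phase is the bounded kernel and the power -1/2 is left with
    \<open>w\<close>. Even for s \<ge> t the term ln (t - s) is some real number, so the phase has
    modulus one everywhere, while the power vanishes there.\<close>
  let ?k = "\<lambda>s \<eta>. exp (\<i> * of_real \<eta> * of_real (ln (t - s)))"
  have split: "pos_powr (t - s) (- 1 / 2 + \<i> * of_real \<eta>) = pos_powr (t - s) (- 1 / 2) * ?k s \<eta>" for s \<eta>
    unfolding pos_powr_add by (simp add: pos_powr_def)
  have "(LINT s|lborel. LINT \<eta>|lborel. (w s * pos_powr (t - s) (- 1 / 2)) * \<phi> \<eta> * ?k s \<eta>)
      = (LINT \<eta>|lborel. LINT s|lborel. (w s * pos_powr (t - s) (- 1 / 2)) * \<phi> \<eta> * ?k s \<eta>)"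
    by (rule fubini_bounded_kernel[OF w \<phi>, where B = 1]) simp_all
  then show ?thesis
    unfolding split integral_mult_right_zero[symmetric] by (simp only: mult_ac)
qed

lemma convolution_of_mellin_superpositions:
  assumes \<phi>: "integrable lborel \<phi>" and \<psi>: "integrable lborel \<psi>"
    and f: "\<And>t. f t = (LINT \<xi>|lborel. \<phi> \<xi> * pos_powr t (- 1 / 2 + \<i> * of_real \<xi>))"
    and g: "\<And>t. g t = (LINT \<eta>|lborel. \<psi> \<eta> * pos_powr t (- 1 / 2 + \<i> * of_real \<eta>))"
  shows "(LINT s|lborel. f s * g (t - s)) = (LINT \<eta>|lborel. \<psi> \<eta> * (LINT \<xi>|lborel. \<phi> \<xi> *
      (pos_powr t (\<i> * of_real (\<xi> + \<eta>)) * Beta (1 / 2 + \<i> * of_real \<xi>) (1 / 2 + \<i> * of_real \<eta>))))"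
proof -
  note [measurable] = borel_measurable_integrable[OF \<phi>]
  have conv: "integrable lborel (\<lambda>s. pos_powr s (- 1 / 2 + \<i> * of_real \<eta>) * pos_powr (t - s) (- 1 / 2))" for \<eta>
    using integrable_pos_powr_convolution[of "1 / 2 + \<i> * of_real \<eta>" "1 / 2" t]
    by (simp add: algebra_simps)
  \<comment> \<open>All powers in the superposition share the modulus s powr (-1/2), so
    \<open>f\<close> inherits that singularity and no worse one.\<close>
  have f_bound: "norm (f s) \<le> norm (pos_powr s (- 1 / 2)) * (LINT \<xi>|lborel. norm (\<phi> \<xi>))" for s
  proof -
    have "norm (f s) \<le> (LINT \<xi>|lborel. norm (\<phi> \<xi> * pos_powr s (- 1 / 2 + \<i> * of_real \<xi>)))"
      unfolding f by (rule integral_norm_bound)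
    also have "\<dots> = norm (pos_powr s (- 1 / 2)) * (LINT \<xi>|lborel. norm (\<phi> \<xi>))"
      by (simp add: norm_mult norm_pos_powr mult.commute)
    finally show ?thesis .
  qed
  have [measurable]: "f \<in> borel_measurable borel"
    unfolding f[abs_def] by measurable
  have fw: "integrable lborel (\<lambda>s. f s * pos_powr (t - s) (- 1 / 2))"
  proof (rule Bochner_Integration.integrable_bound)
    show "integrable lborel (\<lambda>s. of_real (LINT \<xi>|lborel. norm (\<phi> \<xi>)) *
        (pos_powr s (- 1 / 2 + \<i> * of_real 0) * pos_powr (t - s) (- 1 / 2)))"
      by (rule integrable_mult_right[OF conv])
    show "AE s in lborel. norm (f s * pos_powr (t - s) (- 1 / 2)) \<le> norm (complex_of_real (LINT \<xi>|lborel. norm (\<phi> \<xi>)) *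
        (pos_powr s (- 1 / 2 + \<i> * of_real 0) * pos_powr (t - s) (- 1 / 2)))"
    proof (rule AE_I2)
      fix s
      have "norm (f s) * norm (pos_powr (t - s) (- 1 / 2))
          \<le> norm (pos_powr s (- 1 / 2)) * (LINT \<xi>|lborel. norm (\<phi> \<xi>)) * norm (pos_powr (t - s) (- 1 / 2))"
        by (intro mult_right_mono f_bound) simp
      then show "norm (f s * pos_powr (t - s) (- 1 / 2)) \<le> norm (complex_of_real (LINT \<xi>|lborel. norm (\<phi> \<xi>)) *
          (pos_powr s (- 1 / 2 + \<i> * of_real 0) * pos_powr (t - s) (- 1 / 2)))"
        by (simp add: norm_mult mult_ac)
    qed
  qed measurable
  \<comment> \<open>Commutativity moves the superposition of \<open>f\<close> into the second slot,
    where the interchange lemma can be used a second time.\<close>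
  have flip: "(LINT s|lborel. a s * b (t - s)) = (LINT s|lborel. b s * a (t - s))" for a b :: "real \<Rightarrow> complex"
    using lborel_integral_real_affine[of "-1" "\<lambda>s. a s * b (t - s)" t] by (simp add: mult.commute)
  have inner: "(LINT s|lborel. f s * pos_powr (t - s) (- 1 / 2 + \<i> * of_real \<eta>)) =
      (LINT \<xi>|lborel. \<phi> \<xi> * (pos_powr t (\<i> * of_real (\<xi> + \<eta>)) *
        Beta (1 / 2 + \<i> * of_real \<xi>) (1 / 2 + \<i> * of_real \<eta>)))" for \<eta>
  proof -
    have "(LINT s|lborel. f s * pos_powr (t - s) (- 1 / 2 + \<i> * of_real \<eta>))
        = (LINT s|lborel. pos_powr s (- 1 / 2 + \<i> * of_real \<eta>) * f (t - s))" by (rule flip)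
    also have "\<dots> = (LINT \<xi>|lborel. \<phi> \<xi> * (LINT s|lborel. pos_powr s (- 1 / 2 + \<i> * of_real \<eta>) *
        pos_powr (t - s) (- 1 / 2 + \<i> * of_real \<xi>)))"
      unfolding f by (rule convolution_mellin_superposition[OF \<phi> conv])
    also have "\<dots> = (LINT \<xi>|lborel. \<phi> \<xi> * (pos_powr t (\<i> * of_real (\<xi> + \<eta>)) *
        Beta (1 / 2 + \<i> * of_real \<xi>) (1 / 2 + \<i> * of_real \<eta>)))"
    proof -
      have "(LINT s|lborel. pos_powr s (- 1 / 2 + \<i> * of_real \<eta>) * pos_powr (t - s) (- 1 / 2 + \<i> * of_real \<xi>))
        = pos_powr t (\<i> * of_real (\<xi> + \<eta>)) * Beta (1 / 2 + \<i> * of_real \<xi>) (1 / 2 + \<i> * of_real \<eta>)" for \<xi>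
        using complex_Beta_integral[of "1 / 2 + \<i> * of_real \<eta>" "1 / 2 + \<i> * of_real \<xi>" t]
        by (simp add: algebra_simps Beta_commute)
      then show ?thesis by simp
    qed
    finally show ?thesis .
  qed
  have "(LINT s|lborel. f s * g (t - s))
      = (LINT \<eta>|lborel. \<psi> \<eta> * (LINT s|lborel. f s * pos_powr (t - s) (- 1 / 2 + \<i> * of_real \<eta>)))"
    unfolding g by (rule convolution_mellin_superposition[OF \<psi> fw])
  then show ?thesis unfolding inner .
qed

lemma cnj_pos_powr: "cnj (pos_powr t z) = pos_powr t (cnj z)"
  by (simp add: pos_powr_def exp_cnj)

lemma Xi_map_in_test_functions:
  assumes "f \<in> D_space"
  shows "Xi_map f \<in> test_functions"
  unfolding Xi_map_def[abs_def]
  by (intro test_functions_mult_smooth smooth_fun_Gamma mellin_in_test_functions assms)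

lemma laplace_conv_eq:
  assumes f1: "f1 \<in> D_space" and f2: "f2 \<in> D_space"
  shows "laplace_conv (\<lambda>s. cnj (f1 s)) f2 t = of_real (1 / sqrt (2 * pi)) *
    (if t > 0 then fourier_adj (\<lambda>\<xi>. inverse (Gamma (1 + \<i> * of_real \<xi>)) *
      convol (reflect (\<lambda>\<xi>. cnj (Xi_map f1 \<xi>))) (Xi_map f2) \<xi>) (ln t) else 0)"
proof -
  let ?c = "complex_of_real (1 / sqrt (2 * pi))"
  let ?\<phi> = "reflect (\<lambda>\<xi>. cnj (mellin f1 \<xi>))" and ?\<psi> = "mellin f2"
  let ?g = "reflect (\<lambda>\<xi>. cnj (Xi_map f1 \<xi>))" and ?h = "Xi_map f2"
  let ?r = "\<lambda>\<xi>. inverse (Gamma (1 + \<i> * complex_of_real \<xi>))"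
  have rep: "cnj (f1 s) = (LINT \<xi>|lborel. ?c * ?\<phi> \<xi> * pos_powr s (- 1 / 2 + \<i> * of_real \<xi>))" for s
  proof -
    \<comment> \<open>Conjugation turns the exponent -1/2 + i \<xi> into -1/2 - i \<xi>; replacing
      \<xi> by -\<xi> restores it and reflects the density.\<close>
    have "cnj (f1 s) = (LINT \<xi>|lborel. cnj (?c * mellin f1 \<xi> * pos_powr s (- 1 / 2 + \<i> * of_real \<xi>)))"
      by (subst mellin_inversion[OF f1]) (rule Bochner_Integration.integral_cnj[symmetric])
    also have "\<dots> = (LINT \<xi>|lborel. cnj (?c * mellin f1 (- \<xi>) * pos_powr s (- 1 / 2 + \<i> * of_real (- \<xi>))))"
      by (subst lborel_integral_real_affine[of "-1" _ 0]) simp_all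
    finally show ?thesis by (simp add: cnj_pos_powr reflect_def)
  qed
  have int: "integrable lborel (\<lambda>\<xi>. ?c * ?\<phi> \<xi>)" "integrable lborel (\<lambda>\<xi>. ?c * ?\<psi> \<xi>)"
    by (intro integrable_mult_right test_functions_integrable test_functions_reflect_cnj mellin_in_test_functions f1 f2)+
  have beta: "?\<psi> \<eta> * (?\<phi> \<xi> * (pos_powr t (\<i> * of_real (\<xi> + \<eta>)) * Beta (1 / 2 + \<i> * of_real \<xi>) (1 / 2 + \<i> * of_real \<eta>)))
      = ?h \<eta> * (?g \<xi> * (pos_powr t (\<i> * of_real (\<xi> + \<eta>)) * ?r (\<xi> + \<eta>)))" for \<xi> \<eta>
  proof -
    have "Beta (1 / 2 + \<i> * of_real \<xi>) (1 / 2 + \<i> * of_real \<eta>)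
       = Gamma (1 / 2 + \<i> * of_real \<xi>) * Gamma (1 / 2 + \<i> * of_real \<eta>) * ?r (\<xi> + \<eta>)"
      unfolding rGamma_inverse_Gamma[symmetric] by (simp add: Beta_altdef algebra_simps)
    \<comment> \<open>\<open>Gamma\<close> commutes with conjugation, so reflecting and conjugating
      Gamma (1/2 + i \<xi>) returns the same factor.\<close>
    moreover have "?g \<xi> = Gamma (1 / 2 + \<i> * of_real \<xi>) * ?\<phi> \<xi>"
      by (simp add: reflect_def Xi_map_def cnj_Gamma)
    ultimately show ?thesis by (simp only: Xi_map_def mult_ac)
  qed
  have "laplace_conv (\<lambda>s. cnj (f1 s)) f2 t = (LINT s|lborel. cnj (f1 s) * f2 (t - s))"
    \<comment> \<open>Functions in \<open>D_space\<close> vanish on the nonpositive axis, so the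
      restriction to (0, t) may be dropped.\<close>
    unfolding laplace_conv_def set_lebesgue_integral_def
    using f1 f2 by (intro Bochner_Integration.integral_cong) (auto simp: D_space_def indicator_def)
  also have "\<dots> = (LINT \<eta>|lborel. (?c * ?\<psi> \<eta>) * (LINT \<xi>|lborel. (?c * ?\<phi> \<xi>) *
      (pos_powr t (\<i> * of_real (\<xi> + \<eta>)) * Beta (1 / 2 + \<i> * of_real \<xi>) (1 / 2 + \<i> * of_real \<eta>))))"
    by (rule convolution_of_mellin_superpositions[OF int rep mellin_inversion[OF f2]])
  also have "\<dots> = ?c * (?c * (LINT \<eta>|lborel. LINT \<xi>|lborel. ?\<psi> \<eta> * (?\<phi> \<xi> *
      (pos_powr t (\<i> * of_real (\<xi> + \<eta>)) * Beta (1 / 2 + \<i> * of_real \<xi>) (1 / 2 + \<i> * of_real \<eta>)))))"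
    by (simp only: integral_mult_right_zero mult.assoc mult.left_commute[of "?\<psi> \<eta>" ?c for \<eta>])
  also have "\<dots> = ?c * (?c * (LINT \<eta>|lborel. ?h \<eta> * (LINT \<xi>|lborel. ?g \<xi> *
      (pos_powr t (\<i> * of_real (\<xi> + \<eta>)) * ?r (\<xi> + \<eta>)))))"
    unfolding beta integral_mult_right_zero ..
  also have "\<dots> = ?c * (if t > 0 then fourier_adj (\<lambda>\<xi>. ?r \<xi> * convol ?g ?h \<xi>) (ln t) else 0)"
  proof (cases "t > 0")
    case True
    have "(LINT \<eta>|lborel. ?h \<eta> * (LINT \<xi>|lborel. ?g \<xi> * (pos_powr t (\<i> * of_real (\<xi> + \<eta>)) * ?r (\<xi> + \<eta>))))
        = (LINT \<zeta>|lborel. (pos_powr t (\<i> * of_real \<zeta>) * ?r \<zeta>) * convol ?g ?h \<zeta>)"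
    proof (rule integral_convol)
      show "continuous_on UNIV (\<lambda>\<zeta>. pos_powr t (\<i> * of_real \<zeta>) * ?r \<zeta>)"
        using True unfolding pos_powr_def
        by (auto intro!: continuous_intros smooth_fun_continuous_on[OF smooth_fun_rGamma])
    qed (intro test_functions_reflect_cnj Xi_map_in_test_functions f1 f2)+
    also have "?c * \<dots> = fourier_adj (\<lambda>\<xi>. ?r \<xi> * convol ?g ?h \<xi>) (ln t)"
      \<comment> \<open>For t > 0 the power with exponent i \<zeta> is the Fourier kernel at x = ln
        t.\<close>
      using True unfolding fourier_adj_def by (simp add: pos_powr_def mult_ac)
    finally show ?thesis using True by simp
  next
    case False
    then show ?thesis by simp
  qed
  finally show ?thesis .
qed

theorem theorem2p6:
  fixes h b :: "(real \<Rightarrow> complex) \<Rightarrow> complex"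
    and f1 f2 g1 g2 :: "real \<Rightarrow> complex"
  assumes "h \<in> Zplus_dual"
    and "b = b_function h"
    and "f1 \<in> D_space" and "f2 \<in> D_space"
    and "g1 = Xi_map f1" and "g2 = Xi_map f2"
  shows "g1 \<in> test_functions \<and> g2 \<in> test_functions \<and>
    h (laplace_conv (\<lambda>s. cnj (f1 s)) f2) = b (convol (reflect (\<lambda>\<xi>. cnj (g1 \<xi>))) g2)"
proof -
  have g: "g1 \<in> test_functions" "g2 \<in> test_functions"
    using assms by (simp_all add: Xi_map_in_test_functions)
  let ?c = "complex_of_real (1 / sqrt (2 * pi))"
  define W where "W = fourier_adj (\<lambda>\<xi>. inverse (Gamma (1 + \<i> * of_real \<xi>)) *
      convol (reflect (\<lambda>\<xi>. cnj (g1 \<xi>))) g2 \<xi>)"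
  define F where "F t = (if t > 0 then W (ln t) else 0)" for t
  have "W \<in> Z_space"
    unfolding W_def
    by (intro fourier_adj_in_Z_space test_functions_mult_smooth smooth_fun_rGamma
        convol_in_test_functions test_functions_reflect_cnj g)
  then have "F \<in> Zplus_space" by (simp add: Zplus_space_def F_def)
  \<comment> \<open>Antilinearity yields the conjugate of \<open>?c\<close>, which is
    \<open>?c\<close> itself because it is real.\<close>
  then have "h (\<lambda>t. ?c * F t) = cnj ?c * h F"
    using assms(1) unfolding Zplus_dual_def antilinear_on_def by blast
  moreover have "laplace_conv (\<lambda>s. cnj (f1 s)) f2 = (\<lambda>t. ?c * F t)"
    unfolding laplace_conv_eq[OF assms(3,4), abs_def] F_def W_def assms(5,6) ..
  moreover have "b (convol (reflect (\<lambda>\<xi>. cnj (g1 \<xi>))) g2) = ?c * h F"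
    unfolding assms(2) b_function_def fourier_dist_def theta_dist_def W_def[symmetric] F_def ..
  ultimately show ?thesis using g by simp
qed

end
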